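(* For every positive integer $m$, $\sum_{i=1}^n\tilde\theta_i^m=0$ in $\widetilde{FK}_n$.
   Context: Fix $n\ge2$. Let $\mathcal S$ be the set of symbols $[ij]$, $i<j$ integers with $i\not\equiv j\pmod n$; for $i>j$ put $[ij]:=-[ji]$. $\mathcal A$ is the completion of the free algebra on $\mathcal S$ along the filtration by subalgebras generated by $[ij]$ with $|i|,|j|\ge N$. $\widetilde S_n$ is the affine symmetric group with length $\ell$, $t_{ij}$ the reflection swapping $i+rn,j+rn$ for all $r$; $\mathbb A$ is the affine nilCoxeter algebra with basis $A_w$; $[ij]$ acts on the right by $A_w\cdot[ij]=A_{wt_{ij}}$ if $\ell(wt_{ij})=\ell(w)-1$, else $0$; $\mathcal E\subset\mathcal A$ is the subalgebra of elements whose action on each $A_w$ has finitely many nonzero terms. $\widetilde{FK}_n$ is the quotient of $\mathcal E$ by: (a) $[ij]^2=0$; (b) $[ij][kl]=[kl][ij]$ if $i,j,k,l$ have distinct residues; (c) for $i,j,k$ with distinct residues, $[ij][jk]=[jk][ik]+[ik][ij]$ and $[jk][ij]=[ik][jk]+[ik][ij]$; (d) for $i\not\equiv j$, $\sum_{i'\equiv i,\,j'\equiv j}[ij'][ji']=0$; (e) $[i,j]=[i+n,j+n]$. $\tilde\theta_i=\sum_{j\in\mathbb Z,\,j\not\equiv i}[ij]$.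
   Formalization: The completion uses two-sided ideals generated by [ij] with |i| or |j| ≥ N (else θ̃_i is undefined), and E is divided by the ideal of (a)–(e) closed for the filtration by |i−j| (else m=1 fails); proved for (c) as printed and with last term [ij][ik]. *)

theory Defs
  imports "HOL-Algebra.QuotRing" "HOL-Library.Groups_Big_Fun"
begin

section \<open>Residues, reflections and the affine symmetric group\<close>

definition distinct_residues :: "nat \<Rightarrow> int list \<Rightarrow> bool" where
  "distinct_residues n xs \<longleftrightarrow> distinct (map (\<lambda>x. x mod int n) xs)"

definition reflection :: "nat \<Rightarrow> int \<Rightarrow> int \<Rightarrow> int \<Rightarrow> int" where
  "reflection n i j k =
     (if k mod int n = i mod int n then k + (j - i)
      else if k mod int n = j mod int n then k + (i - j)
      else k)"

definition word_product :: "nat \<Rightarrow> nat list \<Rightarrow> int \<Rightarrow> int" where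
  "word_product n ks = foldr (\<lambda>k w. reflection n (int k) (int k + 1) \<circ> w) ks id"

text \<open>The Coxeter group of type affine \<open>A\<close>, in its realization by permutations of the integers:
  the group generated by the simple reflections \<open>s\<^sub>0, \<dots>, s\<^sub>n\<^sub>-\<^sub>1\<close>, where \<open>s\<^sub>k\<close> swaps
  \<open>k + r n\<close> and \<open>k + 1 + r n\<close> for all \<open>r\<close>.\<close>

definition affine_sym :: "nat \<Rightarrow> (int \<Rightarrow> int) set" where
  "affine_sym n = word_product n ` lists {..<n}"

definition aff_length :: "nat \<Rightarrow> (int \<Rightarrow> int) \<Rightarrow> nat" where
  "aff_length n w = (LEAST l. \<exists>ks \<in> lists {..<n}. length ks = l \<and> word_product n ks = w)"


section \<open>The completed free algebra\<close>

text \<open>The letter \<open>(i, j)\<close> stands for the symbol \<open>[ij]\<close> with \<open>i < j\<close>. A formal series is given by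
  its coefficients on words. The coefficient ring is arbitrary.\<close>

type_synonym letter = "int \<times> int"
type_synonym 'k series = "letter list \<Rightarrow> 'k"

definition symbols :: "nat \<Rightarrow> letter set" where
  "symbols n = {(i, j). i < j \<and> distinct_residues n [i, j]}"

definition monomial :: "letter list \<Rightarrow> 'k::comm_ring_1 series" where
  "monomial u = (\<lambda>v. if v = u then 1 else 0)"

definition ser_mult :: "'k::comm_ring_1 series \<Rightarrow> 'k series \<Rightarrow> 'k series" where
  "ser_mult f g = (\<lambda>u. \<Sum>k\<le>length u. f (take k u) * g (drop k u))"

definition free_alg :: "nat \<Rightarrow> 'k::comm_ring_1 series set" where
  "free_alg n = {f. finite {u. f u \<noteq> 0} \<and> {u. f u \<noteq> 0} \<subseteq> lists (symbols n)}"

text \<open>All words of the series contain a letter \<open>[ij]\<close> with \<open>\<bar>i\<bar> \<ge> N\<close> or \<open>\<bar>j\<bar> \<ge> N\<close>.  On the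
  free algebra these are the two-sided ideals generated by such letters. They have to be ideals,
  and one large index has to suffice, for the completion to be an algebra containing
  \<open>\<Sum>\<^sub>j [ij]\<close>.\<close>

definition index_filt :: "nat \<Rightarrow> 'k::comm_ring_1 series set" where
  "index_filt N = {f. \<forall>u. f u \<noteq> 0 \<longrightarrow> (\<exists>(i, j) \<in> set u. int N \<le> \<bar>i\<bar> \<or> int N \<le> \<bar>j\<bar>)}"

text \<open>The completion of the free algebra, realized as its closure among all formal
  series.\<close>

definition completed_alg :: "nat \<Rightarrow> 'k::comm_ring_1 series set" where
  "completed_alg n = {f. {u. f u \<noteq> 0} \<subseteq> lists (symbols n) \<and>
     (\<forall>N. \<exists>p \<in> free_alg n. (\<lambda>u. f u - p u) \<in> index_filt N)}"


section \<open>The action on the affine nilCoxeter algebra\<close>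

text \<open>A letter sends a basis element \<open>A\<^sub>w\<close> to a basis element or to zero: \<open>Some v\<close> stands for
  \<open>A\<^sub>v\<close>, and \<open>None\<close> for \<open>0\<close>. Words act from the right.\<close>

definition act_letter :: "nat \<Rightarrow> (int \<Rightarrow> int) \<Rightarrow> letter \<Rightarrow> (int \<Rightarrow> int) option" where
  "act_letter n w a = (let v = w \<circ> reflection n (fst a) (snd a) in
     if aff_length n w = aff_length n v + 1 then Some v else None)"

fun act_word :: "nat \<Rightarrow> (int \<Rightarrow> int) \<Rightarrow> letter list \<Rightarrow> (int \<Rightarrow> int) option" where
  "act_word n w [] = Some w"
| "act_word n w (a # u) = Option.bind (act_letter n w a) (\<lambda>v. act_word n v u)"

definition finite_action :: "nat \<Rightarrow> 'k::comm_ring_1 series set" where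
  "finite_action n = {f \<in> completed_alg n.
     \<forall>w \<in> affine_sym n. finite {u. f u \<noteq> 0 \<and> act_word n w u \<noteq> None}}"

definition E_alg :: "nat \<Rightarrow> 'k::comm_ring_1 series ring" where
  "E_alg n = \<lparr>carrier = finite_action n, mult = ser_mult, one = monomial [],
     zero = (\<lambda>_. 0), add = (\<lambda>f g u. f u + g u)\<rparr>"


section \<open>The affine Fomin--Kirillov algebra\<close>

text \<open>The element \<open>[ij]\<close>, with \<open>[ij] = - [ji]\<close> for \<open>i > j\<close>.\<close>

definition br :: "int \<Rightarrow> int \<Rightarrow> 'k::comm_ring_1 series" where
  "br i j = (if i < j then monomial [(i, j)] else (\<lambda>u. - monomial [(j, i)] u))"

abbreviation ser_diff :: "'k::comm_ring_1 series \<Rightarrow> 'k series \<Rightarrow> 'k series" where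
  "ser_diff f g \<equiv> (\<lambda>u. f u - g u)"

abbreviation ser_add :: "'k::comm_ring_1 series \<Rightarrow> 'k series \<Rightarrow> 'k series" where
  "ser_add f g \<equiv> (\<lambda>u. f u + g u)"

text \<open>Infinite sum of series, for families in which each word occurs finitely often.\<close>

definition ser_sum :: "'b set \<Rightarrow> ('b \<Rightarrow> 'k::comm_ring_1 series) \<Rightarrow> 'k series" where
  "ser_sum I F = (\<lambda>u. Sum_any (\<lambda>a. if a \<in> I then F a u else 0))"

text \<open>The second three-term relation is found in two forms. \<open>Printed\<close> is
  \<open>[jk][ij] = [ik][jk] + [ik][ij]\<close>. \<open>Mirrored\<close> is \<open>[jk][ij] = [ik][jk] + [ij][ik]\<close>, which is the
  Fomin--Kirillov relation, holds for the action on the nilCoxeter algebra, and already follows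
  from the first relation for the triple \<open>(k, j, i)\<close>. Hence \<open>Mirrored\<close> gives the smaller ideal.\<close>

datatype triangle_form = Printed | Mirrored

inductive_set relators :: "triangle_form \<Rightarrow> nat \<Rightarrow> 'k::comm_ring_1 series set"
  for c :: triangle_form and n :: nat where
  square: "distinct_residues n [i, j] \<Longrightarrow> ser_mult (br i j) (br i j) \<in> relators c n"
| commute: "distinct_residues n [i, j, k, l] \<Longrightarrow>
    ser_diff (ser_mult (br i j) (br k l)) (ser_mult (br k l) (br i j)) \<in> relators c n"
| triangle1: "distinct_residues n [i, j, k] \<Longrightarrow>
    ser_diff (ser_mult (br i j) (br j k))
      (ser_add (ser_mult (br j k) (br i k)) (ser_mult (br i k) (br i j))) \<in> relators c n"
| triangle2: "distinct_residues n [i, j, k] \<Longrightarrow>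
    ser_diff (ser_mult (br j k) (br i j))
      (ser_add (ser_mult (br i k) (br j k))
        (case c of Printed \<Rightarrow> ser_mult (br i k) (br i j)
                 | Mirrored \<Rightarrow> ser_mult (br i j) (br i k))) \<in> relators c n"
| residue_sum: "distinct_residues n [i, j] \<Longrightarrow>
    ser_sum {(i', j'). i' mod int n = i mod int n \<and> j' mod int n = j mod int n}
      (\<lambda>(i', j'). ser_mult (br i j') (br j i')) \<in> relators c n"
| shift: "distinct_residues n [i, j] \<Longrightarrow>
    ser_diff (br i j) (br (i + int n) (j + int n)) \<in> relators c n"

text \<open>All words of the series contain a letter \<open>[ij]\<close> with \<open>\<bar>i - j\<bar> \<ge> N\<close>.\<close>

definition width_filt :: "nat \<Rightarrow> 'k::comm_ring_1 series set" where
  "width_filt N = {f. \<forall>u. f u \<noteq> 0 \<longrightarrow> (\<exists>(i, j) \<in> set u. int N \<le> \<bar>i - j\<bar>)}"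

text \<open>As usual for presentations of topological algebras, the relations generate a closed
  two-sided ideal. (The abstract ideal is too small to express identities between infinite sums:
  its part of degree one consists of finite combinations of the relators \<open>shift\<close>, so it does not
  contain \<open>\<Sum>\<^sub>i \<Sum>\<^sub>j [ij]\<close>, \<open>1 \<le> i \<le> n\<close>.) The closure is taken with respect to the
  shift-invariant filtration by \<open>\<bar>i - j\<bar>\<close>. Since \<open>A\<^sub>w\<close> has only finitely many images under words,
  \<open>A\<^sub>w\<close> is annihilated by \<open>width_filt N\<close> for large \<open>N\<close>, so that the closed ideal has the same
  action as the abstract one. The closure with respect to \<open>index_filt\<close> would not do: by \<open>shift\<close>,
  \<open>[ij]\<close> is congruent to \<open>[i + r n, j + r n]\<close>, which tends to \<open>0\<close> there.\<close>

definition relation_ideal :: "triangle_form \<Rightarrow> nat \<Rightarrow> 'k::comm_ring_1 series set" where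
  "relation_ideal c n = {f \<in> finite_action n.
     \<forall>N. \<exists>g \<in> Idl\<^bsub>E_alg n\<^esub> (relators c n). ser_diff f g \<in> width_filt N}"

definition affine_FK :: "triangle_form \<Rightarrow> nat \<Rightarrow> 'k::comm_ring_1 series set ring" where
  "affine_FK c n = E_alg n Quot relation_ideal c n"

definition dunkl :: "nat \<Rightarrow> int \<Rightarrow> 'k::comm_ring_1 series" where
  "dunkl n i = ser_sum {j. distinct_residues n [i, j]} (\<lambda>j. br i j)"

definition FK_dunkl :: "triangle_form \<Rightarrow> nat \<Rightarrow> int \<Rightarrow> 'k::comm_ring_1 series set" where
  "FK_dunkl c n i = relation_ideal c n +>\<^bsub>E_alg n\<^esub> dunkl n i"

end

theory Submission
  imports Defs
begin

text \<open>Modulo series all of whose words contain a letter of width at least \<open>N\<close>, the sums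
  \<open>X\<^sub>i\<^sub>j = \<Sum>\<^sub>j\<^sub>' [ij']\<close> over \<open>j' \<equiv> j\<close> are finite. They depend only on the residues of \<open>i\<close> and
  \<open>j\<close>, and they satisfy the relations of the finite Fomin--Kirillov algebra: the relation (d) says
  precisely that \<open>X\<^sub>i\<^sub>j\<^sup>2 = 0\<close>. As \<open>\<theta>\<^sub>i = \<Sum>\<^sub>j X\<^sub>i\<^sub>j\<close>, this reduces the theorem to the finite case.

  There, \<open>x\<^sub>i\<^sub>p x\<^sub>i\<^sub>q = x\<^sub>p\<^sub>q x\<^sub>i\<^sub>p - x\<^sub>i\<^sub>q x\<^sub>p\<^sub>q\<close>. For a cyclic sequence starting with \<open>p, q\<close>,
  the sums over all rotations \<open>(a\<^sub>1, \<dots>, a\<^sub>k)\<close> of \<open>x\<^sub>i\<^sub>a\<^sub>1 \<cdots> x\<^sub>i\<^sub>a\<^sub>k x\<^sub>i\<^sub>a\<^sub>1\<close> and of \<open>x\<^sub>a\<^sub>1\<^sub>a\<^sub>2 \<cdots> x\<^sub>a\<^sub>1\<^sub>a\<^sub>k\<close>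
  are therefore both of the form \<open>x\<^sub>p\<^sub>q S' - S'' x\<^sub>p\<^sub>q\<close>, where \<open>S'\<close> and \<open>S''\<close> are the sums for the
  sequences without \<open>q\<close> and without \<open>p\<close>; by induction they vanish. The first family shows that
  \<open>\<theta>\<^sub>i\<^sup>m\<close> is the sum of \<open>x\<^sub>i\<^sub>a\<^sub>1 \<cdots> x\<^sub>i\<^sub>a\<^sub>m\<close> over distinct \<open>a\<^sub>1, \<dots>, a\<^sub>m\<close>, the second one that
  these terms cancel when summed over \<open>i\<close>.\<close>

section \<open>The finite Fomin--Kirillov relations modulo an ideal\<close>

definition rotation_sum :: "('v list \<Rightarrow> 'a::comm_monoid_add) \<Rightarrow> 'v list \<Rightarrow> 'a" where
  "rotation_sum f T = (\<Sum>r<length T. f (drop r T @ take r T))"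

lemma rotation_sum_Cons:
  "rotation_sum f (p # R) = f (p # R) + (\<Sum>r<length R. f (drop r R @ p # take r R))"
  by (simp add: rotation_sum_def sum.lessThan_Suc_shift del: sum.lessThan_Suc)

text \<open>Isolates the two exceptional rotations, the one starting with \<open>p\<close> and the
  one starting with \<open>q\<close>. In all others \<open>p\<close> and \<open>q\<close> are
  adjacent, in this order, behind a head taken from \<open>R\<close>.\<close>

lemma rotation_sum_Cons2:
  "rotation_sum f (p # q # R) =
     f (p # q # R) + f (q # R @ [p]) + (\<Sum>r<length R. f (drop r R @ p # q # take r R))"
  by (simp add: rotation_sum_def sum.lessThan_Suc_shift add.assoc del: sum.lessThan_Suc)

definition distinct_lists :: "nat \<Rightarrow> 'v set \<Rightarrow> 'v list set" where
  "distinct_lists k A = {S. length S = k \<and> distinct S \<and> set S \<subseteq> A}"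

lemma finite_distinct_lists: "finite A \<Longrightarrow> finite (distinct_lists k A)"
  by (rule finite_subset[OF _ finite_lists_length_eq[of A k]]) (auto simp: distinct_lists_def)

lemma distinct_lists_0 [simp]: "distinct_lists 0 A = {[]}"
  by (auto simp: distinct_lists_def)

lemma sum_distinct_lists_append:
  assumes "finite A"
  shows "(\<Sum>S\<in>distinct_lists (k + l) A. f S) =
    (\<Sum>P\<in>distinct_lists k A. \<Sum>Q\<in>distinct_lists l (A - set P). f (P @ Q))"
proof -
  have "(\<Sum>P\<in>distinct_lists k A. \<Sum>Q\<in>distinct_lists l (A - set P). f (P @ Q)) =
    (\<Sum>(P, Q)\<in>(SIGMA P:distinct_lists k A. distinct_lists l (A - set P)). f (P @ Q))"
    by (rule sum.Sigma) (auto intro!: finite_distinct_lists assms)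
  also have "\<dots> = (\<Sum>S\<in>distinct_lists (k + l) A. f S)"
    by (rule sum.reindex_bij_witness[where i = "\<lambda>S. (take k S, drop k S)"
          and j = "\<lambda>(P, Q). P @ Q"])
      (use set_take_disj_set_drop_if_distinct[OF _ order.refl, of _ k] in
        \<open>auto simp: distinct_lists_def dest: in_set_takeD in_set_dropD\<close>)
  finally show ?thesis ..
qed

lemma distinct_lists_1: "distinct_lists (Suc 0) A = (\<lambda>a. [a]) ` A"
  by (auto simp: distinct_lists_def length_Suc_conv)

lemma sum_distinct_lists_Suc:
  assumes "finite A"
  shows "(\<Sum>S\<in>distinct_lists (Suc k) A. f S) =
    (\<Sum>a\<in>A. \<Sum>Q\<in>distinct_lists k (A - {a}). f (a # Q))"
  using sum_distinct_lists_append[OF assms, of f 1 k]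
  by (simp add: distinct_lists_1 sum.reindex inj_on_def)

lemma sum_distinct_lists_Suc_right:
  assumes "finite A"
  shows "(\<Sum>S\<in>distinct_lists (Suc k) A. f S) =
    (\<Sum>P\<in>distinct_lists k A. \<Sum>a\<in>A - set P. f (P @ [a]))"
  using sum_distinct_lists_append[OF assms, of f k 1]
  by (simp add: distinct_lists_1 sum.reindex inj_on_def)

lemma rotate1_in_distinct_lists [simp]:
  "rotate1 S \<in> distinct_lists k A \<longleftrightarrow> S \<in> distinct_lists k A"
  by (simp add: distinct_lists_def)

section \<open>Congruence modulo an ideal of a subring\<close>

locale subring_ideal =
  fixes E J :: "'a::ring_1 set"
  assumes one_E: "1 \<in> E"
    and diff_E: "a \<in> E \<Longrightarrow> b \<in> E \<Longrightarrow> a - b \<in> E"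
    and mult_E: "a \<in> E \<Longrightarrow> b \<in> E \<Longrightarrow> a * b \<in> E"
    and J_sub: "J \<subseteq> E"
    and zero_J: "0 \<in> J"
    and diff_J: "a \<in> J \<Longrightarrow> b \<in> J \<Longrightarrow> a - b \<in> J"
    and mult_J_left: "a \<in> E \<Longrightarrow> b \<in> J \<Longrightarrow> a * b \<in> J"
    and mult_J_right: "b \<in> J \<Longrightarrow> a \<in> E \<Longrightarrow> b * a \<in> J"
begin

text \<open>\<open>J\<close> is an ideal of \<open>E\<close> only, so membership in \<open>E\<close>
  is made part of the congruence. Chains of congruences then carry it along, and products of
  congruences need no side conditions.\<close>

definition cg :: "'a \<Rightarrow> 'a \<Rightarrow> bool"  (infix "\<approx>" 50) where
  "a \<approx> b \<longleftrightarrow> a \<in> E \<and> b \<in> E \<and> a - b \<in> J"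

lemma zero_E: "0 \<in> E"
  using zero_J J_sub by blast

lemma uminus_E: "a \<in> E \<Longrightarrow> - a \<in> E"
  using diff_E[OF zero_E, of a] by simp

lemma add_E: "a \<in> E \<Longrightarrow> b \<in> E \<Longrightarrow> a + b \<in> E"
  using diff_E[of a "- b"] uminus_E[of b] by simp

lemma sum_E: "(\<And>i. i \<in> I \<Longrightarrow> f i \<in> E) \<Longrightarrow> sum f I \<in> E"
  by (induction I rule: infinite_finite_induct) (auto intro: zero_E add_E)

lemma uminus_J: "a \<in> J \<Longrightarrow> - a \<in> J"
  using diff_J[OF zero_J, of a] by simp

lemma add_J: "a \<in> J \<Longrightarrow> b \<in> J \<Longrightarrow> a + b \<in> J"
  using diff_J[of a "- b"] uminus_J[of b] by simp

lemma sum_J: "(\<And>i. i \<in> I \<Longrightarrow> f i \<in> J) \<Longrightarrow> sum f I \<in> J"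
  by (induction I rule: infinite_finite_induct) (auto intro: zero_J add_J)

lemma cg_0_iff: "a \<approx> 0 \<longleftrightarrow> a \<in> J"
  using J_sub zero_E by (auto simp: cg_def)

lemma cg_refl: "a \<in> E \<Longrightarrow> a \<approx> a"
  by (simp add: cg_def zero_J)

lemma cg_sym: "a \<approx> b \<Longrightarrow> b \<approx> a"
  using uminus_J[of "a - b"] by (auto simp: cg_def)

lemma cg_trans [trans]: "a \<approx> b \<Longrightarrow> b \<approx> c \<Longrightarrow> a \<approx> c"
  using add_J[of "a - b" "b - c"] by (auto simp: cg_def)

lemma cg_add: "a \<approx> b \<Longrightarrow> c \<approx> d \<Longrightarrow> a + c \<approx> b + d"
  using add_J[of "a - b" "c - d"] by (auto simp: cg_def add_E algebra_simps)

lemma cg_uminus: "a \<approx> b \<Longrightarrow> - a \<approx> - b"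
  using uminus_J[of "a - b"] by (auto simp: cg_def uminus_E)

lemma cg_diff: "a \<approx> b \<Longrightarrow> c \<approx> d \<Longrightarrow> a - c \<approx> b - d"
  using cg_add[OF _ cg_uminus, of a b c d] by simp

lemma cg_mult: "a \<approx> b \<Longrightarrow> c \<approx> d \<Longrightarrow> a * c \<approx> b * d"
proof -
  assume ab: "a \<approx> b" and cd: "c \<approx> d"
  have "(a - b) * c + b * (c - d) \<in> J"
    using ab cd by (intro add_J mult_J_left mult_J_right) (auto simp: cg_def)
  then show ?thesis
    using ab cd by (auto simp: cg_def mult_E algebra_simps)
qed

lemma cg_sum: "(\<And>i. i \<in> I \<Longrightarrow> f i \<approx> g i) \<Longrightarrow> sum f I \<approx> sum g I"
  by (induction I rule: infinite_finite_induct) (auto intro: cg_refl zero_E cg_add)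

lemma cg_power: "a \<approx> b \<Longrightarrow> a ^ k \<approx> b ^ k"
  by (induction k) (auto intro: cg_refl one_E cg_mult)

lemma cg_J: "a \<approx> b \<Longrightarrow> b \<in> J \<Longrightarrow> a \<in> J"
  using cg_0_iff cg_trans by blast

lemma prod_list_E: "(\<And>s. s \<in> set S \<Longrightarrow> f s \<in> E) \<Longrightarrow> prod_list (map f S) \<in> E"
  by (induction S) (auto intro: one_E mult_E)

lemma cg_prod_list_commute:
  assumes "z \<in> E" "\<And>s. s \<in> set S \<Longrightarrow> f s * z \<approx> z * f s" "\<And>s. s \<in> set S \<Longrightarrow> f s \<in> E"
  shows "prod_list (map f S) * z \<approx> z * prod_list (map f S)"
  using assms(2,3)
proof (induction S)
  case Nil
  then show ?case using assms(1) by (simp add: cg_refl)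
next
  case (Cons s S)
  have "prod_list (map f (s # S)) * z = f s * (prod_list (map f S) * z)"
    by (simp add: mult.assoc)
  also have "\<dots> \<approx> f s * (z * prod_list (map f S))"
    using Cons by (intro cg_mult[OF cg_refl]) auto
  also have "f s * (z * prod_list (map f S)) = (f s * z) * prod_list (map f S)"
    by (simp add: mult.assoc)
  also have "\<dots> \<approx> (z * f s) * prod_list (map f S)"
    using Cons by (intro cg_mult[OF _ cg_refl] prod_list_E) auto
  finally show ?case by (simp add: mult.assoc)
qed

text \<open>Summing orbit by orbit: rotation acts freely on lists of distinct elements, so no division
  by the length is needed.\<close>

lemma sum_J_by_rotation:
  assumes "finite D" "k > 0"
    and "\<And>S. S \<in> D \<Longrightarrow> length S = k \<and> distinct S"
    and "\<And>S. rotate1 S \<in> D \<longleftrightarrow> S \<in> D"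
    and "\<And>S. S \<in> D \<Longrightarrow> rotation_sum f S \<in> J"
  shows "sum f D \<in> J"
  using assms
proof (induction "card D" arbitrary: D rule: less_induct)
  case less
  show ?case
  proof (cases "D = {}")
    case True
    then show ?thesis by (simp add: zero_J)
  next
    case False
    then obtain T where T: "T \<in> D" by blast
    then have len: "length T = k" and dist: "distinct T" using less.prems(3) by auto
    define Orb where "Orb = (\<lambda>r. rotate r T) ` {..<k}"
    have rot_D: "rotate r S \<in> D \<longleftrightarrow> S \<in> D" for r S
      using less.prems(4) by (induction r) (auto simp: rotate_def)
    have O_D: "Orb \<subseteq> D" using T rot_D by (auto simp: Orb_def)
    have mem_O: "S \<in> Orb \<longleftrightarrow> (\<exists>r. S = rotate r T)" for S
    proof
      assume "\<exists>r. S = rotate r T"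
      then obtain r where "S = rotate r T" by blast
      then have "S = rotate (r mod k) T" using rotate_conv_mod[of r T] len by simp
      then show "S \<in> Orb" using less.prems(2) by (auto simp: Orb_def)
    qed (auto simp: Orb_def)
    have rot_O: "rotate1 S \<in> Orb \<longleftrightarrow> S \<in> Orb" if "S \<in> D" for S
    proof
      assume "S \<in> Orb"
      then obtain r where "S = rotate r T" using mem_O by blast
      then have "rotate1 S = rotate (Suc r) T" by simp
      then show "rotate1 S \<in> Orb" using mem_O by blast
    next
      assume "rotate1 S \<in> Orb"
      then obtain r where r: "rotate1 S = rotate r T" using mem_O by blast
      \<comment> \<open>On lists of length \<open>k\<close>, \<open>rotate (k - 1)\<close> inverts
        \<open>rotate1\<close>, so the orbit is also closed backwards.\<close>
      have "S = rotate k S" using less.prems(3)[OF that] by simp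
      also have "\<dots> = rotate (k - 1) (rotate1 S)"
        using less.prems(2) by (cases k) (auto simp: rotate1_rotate_swap)
      also have "\<dots> = rotate (k - 1 + r) T" using r by (simp add: rotate_rotate)
      finally show "S \<in> Orb" using mem_O by blast
    qed
    have inj: "inj_on (\<lambda>r. rotate r T) {..<k}"
    proof (rule inj_onI)
      fix r s assume rs: "r \<in> {..<k}" "s \<in> {..<k}" "rotate r T = rotate s T"
      \<comment> \<open>The first entries of the two rotations are \<open>T ! r\<close> and
        \<open>T ! s\<close>, which differ for \<open>r \<noteq> s\<close> because \<open>T\<close>
        is distinct.\<close>
      then have "rotate r T ! 0 = rotate s T ! 0" by simp
      then have "T ! r = T ! s"
        using rs(1,2) len nth_rotate[of 0 T r] nth_rotate[of 0 T s] by simp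
      then show "r = s" using rs len dist by (simp add: nth_eq_iff_index_eq)
    qed
    have "sum f Orb = (\<Sum>r<k. f (rotate r T))"
      unfolding Orb_def using inj by (simp add: sum.reindex)
    also have "\<dots> = rotation_sum f T"
      unfolding rotation_sum_def len by (rule sum.cong) (auto simp: rotate_drop_take len)
    finally have "sum f Orb \<in> J" using less.prems(5)[OF T] by simp
    \<comment> \<open>Removing a full orbit leaves a smaller set that is again closed under rotation
      in both directions.\<close>
    moreover have "sum f (D - Orb) \<in> J"
    proof (rule less.hyps)
      have "T \<in> Orb" unfolding mem_O by (rule exI[of _ 0]) simp
      then show "card (D - Orb) < card D"
        using T less.prems(1) by (intro psubset_card_mono) auto
      show "rotate1 S \<in> D - Orb \<longleftrightarrow> S \<in> D - Orb" for S
        using rot_O less.prems(4) by blast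
    qed (use less.prems in auto)
    moreover have "sum f D = sum f Orb + sum f (D - Orb)"
      using O_D less.prems(1) by (simp add: sum.subset_diff add.commute)
    ultimately show ?thesis by (simp add: add_J)
  qed
qed

text \<open>In both applications \<open>z\<close> is \<open>x p q\<close>; \<open>c\<close> is the term by which the words starting with
  \<open>p\<close> and with \<open>q\<close> fail to follow the pattern of the others.\<close>

lemma rotation_sum_J_step:
  assumes z: "z \<in> E"
    and p: "rotation_sum f (p # R) \<in> J" and q: "rotation_sum f (q # R) \<in> J"
    and first: "f (p # q # R) \<approx> z * f (p # R) - c"
    and second: "f (q # R @ [p]) \<approx> c - f (q # R) * z"
    and mid: "\<And>r. r < length R \<Longrightarrow> f (drop r R @ p # q # take r R) \<approx>
      z * f (drop r R @ p # take r R) - f (drop r R @ q # take r R) * z"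
  shows "rotation_sum f (p # q # R) \<in> J"
proof (rule cg_J)
  \<comment> \<open>The two occurrences of \<open>c\<close> cancel. The remaining terms are all
    rotations of \<open>p # R\<close>, multiplied by \<open>z\<close> on the left, and all rotations
    of \<open>q # R\<close>, multiplied by \<open>z\<close> on the right.\<close>
  have "(z * f (p # R) - c) + (c - f (q # R) * z)
      + (\<Sum>r<length R. z * f (drop r R @ p # take r R) - f (drop r R @ q # take r R) * z)
      = z * rotation_sum f (p # R) - rotation_sum f (q # R) * z"
    by (simp add: rotation_sum_Cons sum_subtractf sum_distrib_left sum_distrib_right
        distrib_left distrib_right)
  then show "rotation_sum f (p # q # R) \<approx> z * rotation_sum f (p # R) - rotation_sum f (q # R) * z"
    unfolding rotation_sum_Cons2
    using cg_add[OF cg_add[OF first second] cg_sum[OF mid], of "{..<length R}" "\<lambda>r. r"] by simp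
  show "z * rotation_sum f (p # R) - rotation_sum f (q # R) * z \<in> J"
    by (intro diff_J mult_J_left mult_J_right z p q)
qed

end

section \<open>Star words in the finite Fomin-Kirillov algebra\<close>

locale FK_modulo = subring_ideal E J for E J :: "'a::ring_1 set" +
  fixes V :: "'v set" and x :: "'v \<Rightarrow> 'v \<Rightarrow> 'a"
  assumes fin_V: "finite V"
    and x_E: "i \<in> V \<Longrightarrow> j \<in> V \<Longrightarrow> i \<noteq> j \<Longrightarrow> x i j \<in> E"
    and x_anti: "i \<in> V \<Longrightarrow> j \<in> V \<Longrightarrow> i \<noteq> j \<Longrightarrow> x j i \<approx> - x i j"
    and x_square: "i \<in> V \<Longrightarrow> j \<in> V \<Longrightarrow> i \<noteq> j \<Longrightarrow> x i j * x i j \<in> J"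
    and x_commute: "{i, j, k, l} \<subseteq> V \<Longrightarrow> distinct [i, j, k, l] \<Longrightarrow> x i j * x k l \<approx> x k l * x i j"
    and x_triangle: "{i, j, k} \<subseteq> V \<Longrightarrow> distinct [i, j, k] \<Longrightarrow>
      x i j * x j k \<approx> x j k * x i k + x i k * x i j"
begin

abbreviation star_word :: "'v \<Rightarrow> 'v list \<Rightarrow> 'a" where
  "star_word i S \<equiv> prod_list (map (x i) S)"

lemma star_word_E: "i \<in> V \<Longrightarrow> set S \<subseteq> V - {i} \<Longrightarrow> star_word i S \<in> E"
  by (rule prod_list_E) (auto intro: x_E)

text \<open>Antisymmetry turns the two edges at \<open>i\<close> into a path from \<open>p\<close>
  through \<open>i\<close> to \<open>q\<close>, to which \<open>x_triangle\<close> applies. A second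
  use of antisymmetry restores \<open>x i p\<close>.\<close>

lemma star_relation:
  assumes "{i, p, q} \<subseteq> V" "distinct [i, p, q]"
  shows "x i p * x i q \<approx> x p q * x i p - x i q * x p q"
proof -
  have "x i p * x i q \<approx> - x p i * x i q"
    using assms by (intro cg_mult cg_refl x_anti x_E) auto
  also have "- x p i * x i q = - (x p i * x i q)" by simp
  also have "\<dots> \<approx> - (x i q * x p q + x p q * x p i)"
    using assms by (intro cg_uminus x_triangle) auto
  also have "\<dots> \<approx> - (x i q * x p q + x p q * - x i p)"
    using assms by (intro cg_uminus cg_add cg_mult cg_refl mult_E x_anti x_E) auto
  finally show ?thesis by (simp add: algebra_simps)
qed

lemma star_word_commute:
  assumes "{i, p, q} \<subseteq> V" "distinct [i, p, q]" "set S \<subseteq> V - {i, p, q}"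
  shows "star_word i S * x p q \<approx> x p q * star_word i S"
  using assms by (intro cg_prod_list_commute x_commute x_E) auto

text \<open>After \<open>star_relation\<close> at the adjacent pair \<open>p\<close>,
  \<open>q\<close>, the new factor \<open>x p q\<close> has indices disjoint from those of every
  other letter. It therefore travels left through the word of \<open>Q\<close> in one term and right
  through the word of \<open>P\<close> in the other.\<close>

lemma star_word_split:
  assumes "{i, p, q} \<subseteq> V" "distinct [i, p, q]" "set P \<union> set Q \<subseteq> V - {i, p, q}"
  shows "star_word i (Q @ p # q # P) \<approx>
    x p q * star_word i (Q @ p # P) - star_word i (Q @ q # P) * x p q"
proof -
  note E = x_E star_word_E mult_E
  have "star_word i (Q @ p # q # P) = star_word i Q * (x i p * x i q) * star_word i P"
    by (simp add: mult.assoc)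
  also have "\<dots> \<approx> star_word i Q * (x p q * x i p - x i q * x p q) * star_word i P"
    using assms by (intro cg_mult[OF cg_mult[OF cg_refl] cg_refl] star_relation E) auto
  also have "\<dots> = (star_word i Q * x p q) * (x i p * star_word i P)
      - star_word i Q * x i q * (x p q * star_word i P)"
    by (simp add: algebra_simps)
  also have "\<dots> \<approx> (x p q * star_word i Q) * (x i p * star_word i P)
      - star_word i Q * x i q * (star_word i P * x p q)"
    using assms
    by (intro cg_diff cg_mult[OF _ cg_refl[OF mult_E]] cg_mult[OF cg_refl[OF mult_E]]
        star_word_commute cg_sym[OF star_word_commute] E) auto
  finally show ?thesis by (simp add: mult.assoc)
qed

lemma rotation_sum_closed_star:
  assumes "i \<in> V" "T \<noteq> []" "distinct T" "set T \<subseteq> V - {i}"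
  shows "rotation_sum (\<lambda>S. star_word i S * x i (hd S)) T \<in> J"
  using assms
proof (induction T rule: length_induct)
  case (1 T)
  let ?g = "\<lambda>S. star_word i S * x i (hd S)"
  note E = x_E star_word_E mult_E
  \<comment> \<open>For a single entry the sum is one square. Otherwise two adjacent entries
    \<open>p\<close>, \<open>q\<close> are available, and the induction hypothesis is applied with
    one of them deleted.\<close>
  show ?case
  proof (cases "length T = 1")
    case True
    then obtain p where "T = [p]" by (auto simp: length_Suc_conv)
    then show ?thesis using 1 by (auto simp: rotation_sum_def intro: x_square)
  next
    case False
    then obtain p q R where T: "T = p # q # R"
      using 1(3) by (metis One_nat_def length_Cons list.exhaust list.size(3))
    have ipq: "{i, p, q} \<subseteq> V" "distinct [i, p, q]" and R: "set R \<subseteq> V - {i, p, q}"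
      using 1 T by auto
    let ?x = "x p q"
    let ?s = "\<lambda>a. \<Sum>r<length R. ?g (drop r R @ a # take r R)"
    have sub: "set (drop r R) \<union> set (take r R) \<subseteq> V - {i, p, q}" for r
      using R by (auto dest: in_set_takeD in_set_dropD)
    have mid: "?g (drop r R @ p # q # take r R) \<approx>
        ?x * ?g (drop r R @ p # take r R) - ?g (drop r R @ q # take r R) * ?x"
      if r: "r < length R" for r
    proof -
      \<comment> \<open>The closing index \<open>h\<close> lies in \<open>R\<close>, so it differs
        from \<open>p\<close> and \<open>q\<close>. Hence \<open>x i h\<close> commutes with
        \<open>x p q\<close>, which can leave the word on the right.\<close>
      define h where "h = hd (drop r R)"
      have "h \<in> set R" using r by (simp add: h_def hd_drop_conv_nth)
      then have h: "h \<in> V" "h \<noteq> i" "h \<noteq> p" "h \<noteq> q" using R by auto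
      have hd: "hd (drop r R @ S) = h" for S using r by (simp add: h_def)
      have "?g (drop r R @ p # q # take r R) = star_word i (drop r R @ p # q # take r R) * x i h"
        by (simp only: hd)
      also have "\<dots> \<approx> (?x * star_word i (drop r R @ p # take r R)
          - star_word i (drop r R @ q # take r R) * ?x) * x i h"
        using ipq h sub[of r] by (intro cg_mult[OF _ cg_refl] star_word_split E) auto
      also have "\<dots> = ?x * (star_word i (drop r R @ p # take r R) * x i h)
          - star_word i (drop r R @ q # take r R) * (?x * x i h)"
        by (simp add: algebra_simps)
      also have "\<dots> \<approx> ?x * (star_word i (drop r R @ p # take r R) * x i h)
          - star_word i (drop r R @ q # take r R) * (x i h * ?x)"
        using ipq h sub[of r] by (intro cg_diff cg_mult[OF cg_refl x_commute] cg_refl E) auto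
      finally show ?thesis by (simp only: hd mult.assoc)
    qed
    \<comment> \<open>Here the closing factor is \<open>x i p\<close>, which shares an index with
      \<open>x p q\<close>. The product stays as it is and becomes the correction term
      \<open>c\<close> of \<open>rotation_sum_J_step\<close>.\<close>
    have first: "?g (p # q # R) \<approx> ?x * ?g (p # R) - x i q * star_word i R * ?x * x i p"
    proof -
      have "?g (p # q # R) \<approx> (?x * star_word i (p # R) - star_word i (q # R) * ?x) * x i p"
        unfolding list.sel
        using star_word_split[of i p q R "[]"] ipq R
        by (intro cg_mult[OF _ cg_refl] E) (auto simp del: list.map)
      then show ?thesis by (simp add: algebra_simps)
    qed
    \<comment> \<open>The pair \<open>p\<close>, \<open>q\<close> appears across the closing point:
      the last factor of the star word is \<open>x i p\<close> and the closing factor is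
      \<open>x i q\<close>. \<open>star_relation\<close> for these two produces the same correction
      with the opposite sign.\<close>
    have second: "?g (q # R @ [p]) \<approx> x i q * star_word i R * ?x * x i p - ?g (q # R) * ?x"
    proof -
      have "?g (q # R @ [p]) = x i q * star_word i R * (x i p * x i q)"
        by (simp add: mult.assoc)
      also have "\<dots> \<approx> x i q * star_word i R * (?x * x i p - x i q * ?x)"
        using ipq R by (intro cg_mult[OF cg_refl star_relation] E) auto
      finally show ?thesis by (simp add: algebra_simps)
    qed
    have IH: "rotation_sum ?g (a # R) \<in> J" if "a = p \<or> a = q" for a
      using 1(1)[rule_format, of "a # R"] 1(2-) that T by (auto simp: Suc_le_eq)
    show ?thesis
      unfolding T
      by (rule rotation_sum_J_step[OF _ IH IH first second mid]) (use ipq in \<open>auto intro: x_E\<close>)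
  qed
qed

lemma rotation_sum_star:
  assumes "length T \<ge> 2" "distinct T" "set T \<subseteq> V"
  shows "rotation_sum (\<lambda>S. star_word (hd S) (tl S)) T \<in> J"
  using assms
proof (induction T rule: length_induct)
  case (1 T)
  let ?g = "\<lambda>S. star_word (hd S) (tl S)"
  note E = x_E star_word_E mult_E
  obtain p q R where T: "T = p # q # R"
    using 1(2) by (metis Suc_le_length_iff numeral_2_eq_2)
  have pq: "p \<in> V" "q \<in> V" "p \<noteq> q" and R: "set R \<subseteq> V - {p, q}"
    using 1 T by auto
  let ?x = "x p q"
  show ?case
  \<comment> \<open>Deleting an entry from a list of length two would leave the range of the
    induction. There the sum has two terms, which cancel by antisymmetry.\<close>
  proof (cases "R = []")
    case True
    have "x p q + x q p \<approx> x p q + - x p q"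
      using pq by (intro cg_add cg_refl x_E x_anti) auto
    then show ?thesis
      by (simp add: T True rotation_sum_def cg_0_iff)
  next
    case False
    \<comment> \<open>The centre of these words is the head \<open>h\<close> of
      \<open>drop r R\<close>. It differs from \<open>p\<close> and \<open>q\<close>, so the pair is
      split as in a star with centre \<open>h\<close>.\<close>
    have mid: "?g (drop r R @ p # q # take r R) \<approx>
        ?x * ?g (drop r R @ p # take r R) - ?g (drop r R @ q # take r R) * ?x"
      if r: "r < length R" for r
    proof -
      obtain h D where hD: "drop r R = h # D" using r by (cases "drop r R") auto
      then have "set (h # D) \<union> set (take r R) \<subseteq> V - {p, q}"
        using R by (metis Un_subset_iff dual_order.trans set_drop_subset set_take_subset)
      moreover have "distinct (h # D)" "h \<notin> set (take r R)"
        using 1(3) T hD distinct_drop[of R r] set_take_disj_set_drop_if_distinct[of R r r] by auto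
      ultimately show ?thesis
        using star_word_split[of h p q "take r R" D] pq by (simp add: hD del: map_append) blast
    qed
    \<comment> \<open>With \<open>p\<close> as centre, \<open>x p q\<close> is already the leftmost
      factor. With \<open>q\<close> as centre, \<open>x q p\<close> is the rightmost one. So the
      correction term is zero.\<close>
    have first: "?g (p # q # R) \<approx> ?x * ?g (p # R) - 0"
      using pq R by (auto intro!: cg_refl E)
    have second: "?g (q # R @ [p]) \<approx> 0 - ?g (q # R) * ?x"
    proof -
      have "?g (q # R @ [p]) = star_word q R * x q p" by simp
      also have "\<dots> \<approx> star_word q R * - x p q"
        using pq R by (intro cg_mult cg_refl E x_anti) auto
      finally show ?thesis by simp
    qed
    have IH: "rotation_sum ?g (a # R) \<in> J" if "a = p \<or> a = q" for a
      using 1(1)[rule_format, of "a # R"] 1(2-) that T False by (auto simp: Suc_le_eq)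
    show ?thesis
      unfolding T
      by (rule rotation_sum_J_step[OF _ IH IH first second mid]) (use pq in \<open>auto intro: x_E\<close>)
  qed
qed

text \<open>Handles the words in which a letter recurs: \<open>P\<close> is the part before the
  first occurrence of that letter, and from there on the word is a closed star word on indices
  outside \<open>P\<close>. These indices form a set on whose lists rotation acts.\<close>

lemma sum_closed_star_words:
  assumes i: "i \<in> V" and P: "set P \<subseteq> V - {i}" and k: "k > 0"
  shows "(\<Sum>Q\<in>distinct_lists k (V - {i} - set P). star_word i Q * x i (hd Q)) \<in> J"
proof (rule sum_J_by_rotation[where k = k])
  fix S assume "S \<in> distinct_lists k (V - {i} - set P)"
  then show "length S = k \<and> distinct S"
    and "rotation_sum (\<lambda>Q. star_word i Q * x i (hd Q)) S \<in> J"
    using rotation_sum_closed_star[of i S] i k by (auto simp: distinct_lists_def)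
qed (use k fin_V in \<open>auto intro: finite_distinct_lists\<close>)

lemma dunkl_power:
  assumes i: "i \<in> V"
  shows "(\<Sum>j\<in>V - {i}. x i j) ^ k \<approx> (\<Sum>S\<in>distinct_lists k (V - {i}). star_word i S)"
proof (induction k)
  case 0
  then show ?case by (simp add: cg_refl one_E)
next
  case (Suc k)
  let ?A = "V - {i}"
  let ?W = "star_word i"
  have fin: "finite ?A" using fin_V by simp
  have W_E: "?W S \<in> E" if "S \<in> distinct_lists k ?A" for S k
    using that i star_word_E by (auto simp: distinct_lists_def)
  \<comment> \<open>Products in which the new letter repeats an old one. The repeated index is
    replaced by its position \<open>r\<close> in \<open>S\<close>, which allows the sums to be
    exchanged.\<close>
  have "(\<Sum>S\<in>distinct_lists k ?A. \<Sum>a\<in>set S. ?W S * x i a)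
      = (\<Sum>S\<in>distinct_lists k ?A. \<Sum>r<k. ?W S * x i (S ! r))"
    by (intro sum.cong refl, rule sum.reindex_bij_betw[symmetric, OF bij_betw_nth])
      (auto simp: distinct_lists_def)
  also have "\<dots> = (\<Sum>r<k. \<Sum>S\<in>distinct_lists k ?A. ?W S * x i (S ! r))"
    by (rule sum.swap)
  also have "\<dots> \<in> J"
  proof (rule sum_J)
    fix r assume "r \<in> {..<k}"
    then have r: "r < k" by simp
    \<comment> \<open>Cut \<open>S\<close> at position \<open>r\<close>. The second piece is
      nonempty and its head is the repeated index.\<close>
    have "(\<Sum>S\<in>distinct_lists k ?A. ?W S * x i (S ! r))
        = (\<Sum>P\<in>distinct_lists r ?A. \<Sum>Q\<in>distinct_lists (k - r) (?A - set P).
            ?W (P @ Q) * x i ((P @ Q) ! r))"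
      using sum_distinct_lists_append[OF fin, of "\<lambda>S. ?W S * x i (S ! r)" r "k - r"] r by simp
    also have "\<dots> = (\<Sum>P\<in>distinct_lists r ?A. ?W P *
        (\<Sum>Q\<in>distinct_lists (k - r) (?A - set P). ?W Q * x i (hd Q)))"
      unfolding sum_distrib_left
    proof (intro sum.cong refl)
      fix P Q assume "P \<in> distinct_lists r ?A" "Q \<in> distinct_lists (k - r) (?A - set P)"
      then have "length P = r" "Q \<noteq> []" using r by (auto simp: distinct_lists_def)
      then show "?W (P @ Q) * x i ((P @ Q) ! r) = ?W P * (?W Q * x i (hd Q))"
        by (simp add: nth_append hd_conv_nth mult.assoc)
    qed
    also have "\<dots> \<in> J"
      using r i by (intro sum_J mult_J_left sum_closed_star_words W_E) (auto simp: distinct_lists_def)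
    finally show "(\<Sum>S\<in>distinct_lists k ?A. ?W S * x i (S ! r)) \<in> J" .
  qed
  finally have rep: "(\<Sum>S\<in>distinct_lists k ?A. \<Sum>a\<in>set S. ?W S * x i a) \<approx> 0"
    by (simp add: cg_0_iff)
  have "(\<Sum>j\<in>?A. x i j) ^ Suc k = (\<Sum>j\<in>?A. x i j) ^ k * (\<Sum>j\<in>?A. x i j)"
    by (rule power_Suc2)
  also have "\<dots> \<approx> (\<Sum>S\<in>distinct_lists k ?A. ?W S) * (\<Sum>j\<in>?A. x i j)"
    using i by (intro cg_mult Suc cg_refl sum_E x_E) auto
  also have "\<dots> = (\<Sum>S\<in>distinct_lists k ?A. \<Sum>a\<in>?A. ?W S * x i a)"
    by (simp add: sum_product)
  \<comment> \<open>The next index is either new, which lengthens the list of distinct indices, or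
    repeated, which contributes an element of \<open>J\<close> by \<open>rep\<close>.\<close>
  also have "\<dots> = (\<Sum>S\<in>distinct_lists k ?A. (\<Sum>a\<in>?A - set S. ?W S * x i a)
      + (\<Sum>a\<in>set S. ?W S * x i a))"
    by (intro sum.cong refl sum.subset_diff fin) (auto simp: distinct_lists_def)
  also have "\<dots> = (\<Sum>S\<in>distinct_lists (Suc k) ?A. ?W S)
      + (\<Sum>S\<in>distinct_lists k ?A. \<Sum>a\<in>set S. ?W S * x i a)"
    by (simp add: sum.distrib sum_distinct_lists_Suc_right[OF fin])
  also have "\<dots> \<approx> (\<Sum>S\<in>distinct_lists (Suc k) ?A. ?W S) + 0"
    by (intro cg_add rep cg_refl sum_E W_E)
  finally show ?case by simp
qed

theorem dunkl_power_sum: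
  assumes "m \<ge> 1"
  shows "(\<Sum>i\<in>V. (\<Sum>j\<in>V - {i}. x i j) ^ m) \<in> J"
proof (rule cg_J)
  show "(\<Sum>i\<in>V. (\<Sum>j\<in>V - {i}. x i j) ^ m) \<approx>
      (\<Sum>i\<in>V. \<Sum>S\<in>distinct_lists m (V - {i}). star_word i S)"
    by (intro cg_sum dunkl_power)
  \<comment> \<open>Prepending the centre to its list gives one sum over lists of
    \<open>m + 1\<close> distinct elements. Rotation now changes the centre, and
    \<open>m \<ge> 1\<close> provides the length two that \<open>rotation_sum_star\<close>
    requires.\<close>
  have "(\<Sum>i\<in>V. \<Sum>S\<in>distinct_lists m (V - {i}). star_word i S)
      = (\<Sum>T\<in>distinct_lists (Suc m) V. star_word (hd T) (tl T))"
    using sum_distinct_lists_Suc[OF fin_V, of "\<lambda>T. star_word (hd T) (tl T)" m] by simp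
  also have "\<dots> \<in> J"
  proof (rule sum_J_by_rotation[where k = "Suc m"])
    fix S assume "S \<in> distinct_lists (Suc m) V"
    then show "length S = Suc m \<and> distinct S"
      and "rotation_sum (\<lambda>T. star_word (hd T) (tl T)) S \<in> J"
      using rotation_sum_star[of S] assms by (auto simp: distinct_lists_def)
  qed (use fin_V in \<open>auto intro: finite_distinct_lists\<close>)
  finally show "(\<Sum>i\<in>V. \<Sum>S\<in>distinct_lists m (V - {i}). star_word i S) \<in> J" .
qed

end

section \<open>From affine to finite relations\<close>

definition near :: "nat \<Rightarrow> nat \<Rightarrow> int \<Rightarrow> int \<Rightarrow> int set" where
  "near n N i j = {j'. j' mod int n = j mod int n \<and> \<bar>j' - i\<bar> < int N}"

lemma finite_near: "finite (near n N i j)"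
  by (rule finite_subset[of _ "{i - int N..i + int N}"]) (auto simp: near_def)

lemma mod_add_diff_eq:
  fixes a b c m :: int
  shows "b mod m = c mod m \<Longrightarrow> (a + b - c) mod m = a mod m"
  by (metis add_diff_cancel_right' mod_add_right_eq mod_diff_left_eq)

lemma mod_add_diff_eq':
  fixes a b c m :: int
  shows "b mod m = c mod m \<Longrightarrow> (b + a - c) mod m = a mod m"
  using mod_add_diff_eq[of b m c a] by (simp add: add.commute)

context subring_ideal
begin

lemma cg_sum_subset:
  assumes "finite T'" "T \<subseteq> T'" "\<And>t. t \<in> T' \<Longrightarrow> f t \<in> E" "\<And>t. t \<in> T' - T \<Longrightarrow> f t \<in> J"
  shows "sum f T' \<approx> sum f T"
proof -
  have "sum f T' - sum f T = sum f (T' - T)"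
    using assms(1,2) by (simp add: sum_diff)
  moreover have "sum f (T' - T) \<in> J" using assms(4) by (intro sum_J)
  ultimately show ?thesis using assms(2,3) by (auto simp: cg_def intro!: sum_E)
qed

end

text \<open>\<open>b i j\<close> represents [ij] modulo an ideal that contains the letters of width
  at least \<open>N\<close>. Sums over a residue class then reduce to \<open>near\<close>, and the
  double sum in relation (d) factors into the product of two finite sums in
  \<open>b_residue\<close>.\<close>

locale affine_FK_modulo = subring_ideal E J for E J :: "'a::ring_1 set" +
  fixes n N :: nat and b :: "int \<Rightarrow> int \<Rightarrow> 'a"
  assumes n_pos: "n > 0"
    and b_E: "distinct_residues n [i, j] \<Longrightarrow> b i j \<in> E"
    and b_anti: "distinct_residues n [i, j] \<Longrightarrow> b j i = - b i j"
    and b_commute: "distinct_residues n [i, j, k, l] \<Longrightarrow> b i j * b k l \<approx> b k l * b i j"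
    and b_triangle: "distinct_residues n [i, j, k] \<Longrightarrow>
      b i j * b j k \<approx> b j k * b i k + b i k * b i j"
    and b_residue: "distinct_residues n [i, j] \<Longrightarrow>
      (\<Sum>j'\<in>near n N i j. b i j') * (\<Sum>i'\<in>near n N j i. b j i') \<in> J"
    and b_shift: "distinct_residues n [i, j] \<Longrightarrow> b i j \<approx> b (i + int n) (j + int n)"
    and b_wide: "distinct_residues n [i, j] \<Longrightarrow> int N \<le> \<bar>i - j\<bar> \<Longrightarrow> b i j \<in> J"
begin

definition X :: "int \<Rightarrow> int \<Rightarrow> 'a" where
  "X i j = (\<Sum>j'\<in>near n N i j. b i j')"

lemma b_shift_nat:
  "distinct_residues n [i, j] \<Longrightarrow> b i j \<approx> b (i + int n * int r) (j + int n * int r)"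
proof (induction r)
  case 0
  then show ?case by (simp add: cg_refl b_E)
next
  case (Suc r)
  have "b i j \<approx> b (i + int n * int r) (j + int n * int r)" using Suc by simp
  also have "\<dots> \<approx> b (i + int n * int r + int n) (j + int n * int r + int n)"
    using Suc.prems by (intro b_shift) (simp add: distinct_residues_def)
  finally show ?case by (simp add: algebra_simps)
qed

lemma b_shift_cong:
  assumes "distinct_residues n [i, j]" "i' - i = j' - j" "i mod int n = i' mod int n"
  shows "b i j \<approx> b i' j'"
proof -
  \<comment> \<open>Translation by a nonnegative multiple of \<open>n\<close>. A negative
    translation is obtained by exchanging the two pairs and using symmetry of the
    congruence.\<close>
  have up: "b i j \<approx> b i' j'"
    if "distinct_residues n [i, j]" "i' - i = j' - j" "i mod int n = i' mod int n" "i \<le> i'"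
    for i j i' j'
  proof -
    from that(3) obtain q where q: "i' - i = int n * q"
      by (metis mod_eq_dvd_iff dvd_def)
    with that(4) n_pos have "0 \<le> q"
      by (metis diff_ge_0_iff_ge of_nat_0_less_iff zero_le_mult_iff linorder_not_less)
    then have "i' = i + int n * int (nat q)" "j' = j + int n * int (nat q)"
      using q that(2) by auto
    then show ?thesis using b_shift_nat[OF that(1), of "nat q"] by (simp only:)
  qed
  show ?thesis
  proof (cases "i \<le> i'")
    case True
    then show ?thesis using up assms by blast
  next
    case False
    have "j' = j + i' - i" using assms(2) by simp
    then have "j' mod int n = j mod int n" using mod_add_diff_eq[of i' "int n" i j] assms(3) by simp
    then show ?thesis
      using False assms by (intro cg_sym[OF up]) (auto simp: distinct_residues_def)
  qed
qed

lemma X_E: "distinct_residues n [i, j] \<Longrightarrow> X i j \<in> E"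
  unfolding X_def by (intro sum_E b_E) (auto simp: near_def distinct_residues_def)

text \<open>Translating \<open>b i' j\<close> by \<open>i - i'\<close>, a multiple of
  \<open>n\<close>, moves its first index to \<open>i\<close>. The substitution
  \<open>i' \<mapsto> i + j - i'\<close> preserves widths and so matches the two truncated
  classes.\<close>

lemma X_anti:
  assumes "distinct_residues n [i, j]"
  shows "X j i \<approx> - X i j"
proof -
  have "X i j = (\<Sum>i'\<in>near n N j i. b i (i + j - i'))"
    unfolding X_def
    by (rule sum.reindex_bij_witness[where i = "\<lambda>i'. i + j - i'" and j = "\<lambda>j'. i + j - j'"])
      (auto simp: near_def mod_add_diff_eq mod_add_diff_eq' abs_minus_commute)
  moreover have "X j i \<approx> (\<Sum>i'\<in>near n N j i. - b i (i + j - i'))"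
    unfolding X_def
  proof (rule cg_sum)
    fix i' assume i': "i' \<in> near n N j i"
    then have dr: "distinct_residues n [i', j]"
      using assms by (simp add: near_def distinct_residues_def)
    then have "b j i' = - b i' j" by (rule b_anti)
    also have "\<dots> \<approx> - b i (i + j - i')"
      using i' dr by (intro cg_uminus b_shift_cong) (auto simp: near_def)
    finally show "b j i' \<approx> - b i (i + j - i')" .
  qed
  ultimately show ?thesis by (simp add: sum_negf)
qed

text \<open>Relation (d) puts \<open>X i j * X j i\<close> into \<open>J\<close>, and antisymmetry
  makes this a square up to sign.\<close>

lemma X_square:
  assumes "distinct_residues n [i, j]"
  shows "X i j * X i j \<in> J"
proof -
  have "X i j * X i j = - (X i j * - X i j)" by simp
  also have "\<dots> \<approx> - (X i j * X j i)"
    using assms by (intro cg_uminus cg_mult cg_refl cg_sym[OF X_anti] X_E)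
  finally show ?thesis
    using b_residue[OF assms] by (auto intro: cg_J uminus_J simp: X_def)
qed

lemma X_commute:
  assumes "distinct_residues n [i, j, k, l]"
  shows "X i j * X k l \<approx> X k l * X i j"
proof -
  have "X i j * X k l \<approx> (\<Sum>j'\<in>near n N i j. \<Sum>l'\<in>near n N k l. b k l' * b i j')"
    unfolding X_def sum_product
    using assms by (intro cg_sum b_commute) (auto simp: near_def distinct_residues_def)
  also have "\<dots> = X k l * X i j"
    unfolding X_def sum_product by (rule sum.swap)
  finally show ?thesis .
qed

text \<open>Each product is a sum over triangles \<open>(i, j', k')\<close> with \<open>i\<close>
  fixed in which two prescribed sides are narrow: \<open>T1\<close>, \<open>T2\<close> and
  \<open>T3\<close>. If the third side is wide, \<open>b_triangle\<close> expresses the product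
  through two terms that contain this side, so it lies in \<open>J\<close>. What remains in all
  three cases is \<open>T\<close>, where all sides are narrow and the relation holds term by
  term.\<close>

lemma X_triangle:
  assumes dr: "distinct_residues n [i, j, k]"
  shows "X i j * X j k \<approx> X j k * X i k + X i k * X i j"
proof -
  note res = distinct_residues_def near_def
  define T where "T = {(j', k'). j' \<in> near n N i j \<and> k' \<in> near n N i k \<and> \<bar>k' - j'\<bar> < int N}"
  define T1 where "T1 = (SIGMA j':near n N i j. near n N j' k)"
  define T2 where "T2 = {(j', k'). k' \<in> near n N i k \<and> j' \<in> near n N k' j}"
  define T3 where "T3 = near n N i j \<times> near n N i k"
  have T_dr: "distinct_residues n [i, j', k']" if "(j', k') \<in> T \<union> T1 \<union> T2 \<union> T3" for j' k'
    using that dr by (auto simp: T_def T1_def T2_def T3_def res)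
  have dr2: "distinct_residues n [i, j']" "distinct_residues n [j', k']" "distinct_residues n [i, k']"
    if "distinct_residues n [i, j', k']" for j' k'
    using that by (auto simp: res)
  have T_E: "b i j' \<in> E" "b j' k' \<in> E" "b i k' \<in> E"
    if "(j', k') \<in> T1 \<or> (j', k') \<in> T2 \<or> (j', k') \<in> T3" for j' k'
    using T_dr[of j' k'] that dr2[of j' k'] b_E by auto
  have T2_eq: "T2 = prod.swap ` (SIGMA k':near n N i k. near n N k' j)"
    by (auto simp: T2_def)
  have fin: "finite T1" "finite T2" "finite T3"
    unfolding T1_def T2_eq T3_def by (auto simp: finite_near)
  have "X i j * X j k \<approx> (\<Sum>j'\<in>near n N i j. \<Sum>k'\<in>near n N j' k. b i j' * b j' k')"
    unfolding X_def sum_distrib_right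
  proof (rule cg_sum)
    fix j' assume j': "j' \<in> near n N i j"
    \<comment> \<open>Translation by \<open>j' - j\<close> moves the starting point of the second
      factor from \<open>j\<close> to \<open>j'\<close>, so that the two factors form the path
      \<open>i\<close>, \<open>j'\<close>, \<open>k'\<close>.\<close>
    have bij: "(\<Sum>k'\<in>near n N j' k. b j' k') = (\<Sum>k'\<in>near n N j k. b j' (k' + j' - j))"
      by (rule sum.reindex_bij_witness[where i = "\<lambda>k'. k' + j' - j" and j = "\<lambda>k'. k' + j - j'"])
        (use j' in \<open>auto simp: near_def mod_add_diff_eq\<close>)
    have "(\<Sum>k'\<in>near n N j k. b j k') \<approx> (\<Sum>k'\<in>near n N j' k. b j' k')"
      unfolding bij
      using j' dr by (intro cg_sum b_shift_cong) (auto simp: res)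
    then have "b i j' * (\<Sum>k'\<in>near n N j k. b j k') \<approx> b i j' * (\<Sum>k'\<in>near n N j' k. b j' k')"
      using j' dr by (intro cg_mult cg_refl b_E) (auto simp: res)
    then show "b i j' * (\<Sum>k'\<in>near n N j k. b j k') \<approx> (\<Sum>k'\<in>near n N j' k. b i j' * b j' k')"
      by (simp add: sum_distrib_left)
  qed
  also have "(\<Sum>j'\<in>near n N i j. \<Sum>k'\<in>near n N j' k. b i j' * b j' k')
      = (\<Sum>(j', k')\<in>T1. b i j' * b j' k')"
    unfolding T1_def by (rule sum.Sigma) (auto simp: finite_near)
  also have "\<dots> \<approx> (\<Sum>(j', k')\<in>T. b i j' * b j' k')"
  proof (rule cg_sum_subset[OF fin(1)])
    show "T \<subseteq> T1" by (auto simp: T_def T1_def res)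
    fix t assume "t \<in> T1"
    then show "(case t of (j', k') \<Rightarrow> b i j' * b j' k') \<in> E"
      using T_E[of "fst t" "snd t"] by (cases t) (auto intro: mult_E)
  next
    fix t assume t: "t \<in> T1 - T"
    obtain j' k' where jk: "t = (j', k')" by (cases t)
    with t have dr': "distinct_residues n [i, j', k']" using T_dr by auto
    from t jk have wide: "b i k' \<in> J"
      using dr2[OF dr'] by (intro b_wide) (auto simp: T_def T1_def res abs_minus_commute)
    have "b j' k' * b i k' + b i k' * b i j' \<in> J"
      using dr2[OF dr'] wide by (intro add_J mult_J_left mult_J_right b_E) auto
    then show "(case t of (j', k') \<Rightarrow> b i j' * b j' k') \<in> J"
      using b_triangle[OF dr'] jk cg_J by auto
  qed
  finally have 1: "X i j * X j k \<approx> (\<Sum>(j', k')\<in>T. b i j' * b j' k')" .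

  have "X j k * X i k \<approx> (\<Sum>k'\<in>near n N i k. \<Sum>j'\<in>near n N k' j. b j' k' * b i k')"
    unfolding X_def sum_distrib_left
  proof (rule cg_sum)
    fix k' assume k': "k' \<in> near n N i k"
    \<comment> \<open>Here the end point \<open>k'\<close> is prescribed. The letter from
      \<open>j\<close> to \<open>l\<close> is translated to end at \<open>k'\<close>, so it starts
      at \<open>j + k' - l\<close>.\<close>
    have bij: "(\<Sum>j'\<in>near n N k' j. b j' k') = (\<Sum>l\<in>near n N j k. b (j + k' - l) k')"
      by (rule sum.reindex_bij_witness[where i = "\<lambda>l. j + k' - l" and j = "\<lambda>j'. j + k' - j'"])
        (use k' in \<open>auto simp: near_def mod_add_diff_eq mod_add_diff_eq' abs_minus_commute\<close>)
    have "(\<Sum>l\<in>near n N j k. b j l) \<approx> (\<Sum>j'\<in>near n N k' j. b j' k')"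
      unfolding bij
      using k' dr by (intro cg_sum b_shift_cong) (auto simp: res mod_add_diff_eq)
    then have "(\<Sum>l\<in>near n N j k. b j l) * b i k' \<approx> (\<Sum>j'\<in>near n N k' j. b j' k') * b i k'"
      using k' dr by (intro cg_mult cg_refl b_E) (auto simp: res)
    then show "(\<Sum>l\<in>near n N j k. b j l) * b i k' \<approx> (\<Sum>j'\<in>near n N k' j. b j' k' * b i k')"
      by (simp add: sum_distrib_right)
  qed
  also have "(\<Sum>k'\<in>near n N i k. \<Sum>j'\<in>near n N k' j. b j' k' * b i k')
      = (\<Sum>(j', k')\<in>T2. b j' k' * b i k')"
    unfolding T2_eq by (subst sum.Sigma) (auto simp: finite_near sum.reindex intro!: sum.cong)
  also have "\<dots> \<approx> (\<Sum>(j', k')\<in>T. b j' k' * b i k')"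
  proof (rule cg_sum_subset[OF fin(2)])
    show "T \<subseteq> T2" by (auto simp: T_def T2_def res abs_minus_commute)
    fix t assume "t \<in> T2"
    then show "(case t of (j', k') \<Rightarrow> b j' k' * b i k') \<in> E"
      using T_E[of "fst t" "snd t"] by (cases t) (auto intro: mult_E)
  next
    fix t assume t: "t \<in> T2 - T"
    obtain j' k' where jk: "t = (j', k')" by (cases t)
    with t have dr': "distinct_residues n [i, j', k']" using T_dr by auto
    from t jk have wide: "b i j' \<in> J"
      using dr2[OF dr'] by (intro b_wide) (auto simp: T_def T2_def res abs_minus_commute)
    have "b i j' * b j' k' - b i k' * b i j' \<in> J"
      using dr2[OF dr'] wide by (intro diff_J mult_J_left mult_J_right b_E) auto
    moreover have "b j' k' * b i k' \<approx> b i j' * b j' k' - b i k' * b i j'"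
      using cg_diff[OF cg_sym[OF b_triangle[OF dr']] cg_refl[of "b i k' * b i j'"]] dr2[OF dr']
      by (simp add: mult_E b_E)
    ultimately show "(case t of (j', k') \<Rightarrow> b j' k' * b i k') \<in> J"
      using jk cg_J by auto
  qed
  finally have 2: "X j k * X i k \<approx> (\<Sum>(j', k')\<in>T. b j' k' * b i k')" .

  have "X i k * X i j = (\<Sum>(j', k')\<in>T3. b i k' * b i j')"
    unfolding X_def T3_def sum_product sum.cartesian_product[symmetric] by (rule sum.swap)
  also have "\<dots> \<approx> (\<Sum>(j', k')\<in>T. b i k' * b i j')"
  proof (rule cg_sum_subset[OF fin(3)])
    show "T \<subseteq> T3" by (auto simp: T_def T3_def)
    fix t assume "t \<in> T3"
    then show "(case t of (j', k') \<Rightarrow> b i k' * b i j') \<in> E"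
      using T_E[of "fst t" "snd t"] by (cases t) (auto intro: mult_E)
  next
    fix t assume t: "t \<in> T3 - T"
    obtain j' k' where jk: "t = (j', k')" by (cases t)
    with t have dr': "distinct_residues n [i, j', k']" using T_dr by auto
    from t jk have wide: "b j' k' \<in> J"
      using dr2[OF dr'] by (intro b_wide) (auto simp: T_def T3_def abs_minus_commute)
    have "b i j' * b j' k' - b j' k' * b i k' \<in> J"
      using dr2[OF dr'] wide by (intro diff_J mult_J_left mult_J_right b_E) auto
    moreover have "b i k' * b i j' \<approx> b i j' * b j' k' - b j' k' * b i k'"
      using cg_diff[OF cg_sym[OF b_triangle[OF dr']] cg_refl[of "b j' k' * b i k'"]] dr2[OF dr']
      by (simp add: mult_E b_E)
    ultimately show "(case t of (j', k') \<Rightarrow> b i k' * b i j') \<in> J"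
      using jk cg_J by auto
  qed
  finally have 3: "X i k * X i j \<approx> (\<Sum>(j', k')\<in>T. b i k' * b i j')" .

  have "(\<Sum>(j', k')\<in>T. b i j' * b j' k')
      \<approx> (\<Sum>t\<in>T. (case t of (j', k') \<Rightarrow> b j' k' * b i k') + (case t of (j', k') \<Rightarrow> b i k' * b i j'))"
    by (rule cg_sum) (use T_dr b_triangle in auto)
  then have "(\<Sum>(j', k')\<in>T. b i j' * b j' k')
      \<approx> (\<Sum>(j', k')\<in>T. b j' k' * b i k') + (\<Sum>(j', k')\<in>T. b i k' * b i j')"
    by (simp only: sum.distrib)
  from cg_trans[OF cg_trans[OF 1 this] cg_add[OF cg_sym[OF 2] cg_sym[OF 3]]] show ?thesis .
qed

lemma distinct_residues_iff:
  assumes "set xs \<subseteq> {1..int n}"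
  shows "distinct_residues n xs \<longleftrightarrow> distinct xs"
proof -
  have "inj_on (\<lambda>x. x mod int n) {1..int n}"
  proof (rule inj_onI)
    fix x y assume xy: "x \<in> {1..int n}" "y \<in> {1..int n}" "x mod int n = y mod int n"
    then have "int n dvd x - y" by (simp add: mod_eq_dvd_iff)
    moreover have "\<bar>x - y\<bar> < int n" using xy by auto
    ultimately show "x = y"
      using dvd_imp_le_int[of "x - y" "int n"] by fastforce
  qed
  then show ?thesis
    using assms by (auto simp: distinct_residues_def distinct_map intro: inj_on_subset)
qed

theorem X_power_sum:
  assumes "m \<ge> 1"
  shows "(\<Sum>i\<in>{1..int n}. (\<Sum>j\<in>{1..int n} - {i}. X i j) ^ m) \<in> J"
proof -
  interpret FK_modulo E J "{1..int n}" X
  proof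
    fix i j k l
    let ?V = "{1..int n}"
    show "finite ?V" by simp
    show "X i j \<in> E" "X j i \<approx> - X i j" "X i j * X i j \<in> J" if "i \<in> ?V" "j \<in> ?V" "i \<noteq> j"
      using that distinct_residues_iff[of "[i, j]"] by (auto intro: X_E X_anti X_square)
    show "X i j * X k l \<approx> X k l * X i j" if "{i, j, k, l} \<subseteq> ?V" "distinct [i, j, k, l]"
      using that distinct_residues_iff[of "[i, j, k, l]"] by (intro X_commute) auto
    show "X i j * X j k \<approx> X j k * X i k + X i k * X i j"
      if "{i, j, k} \<subseteq> ?V" "distinct [i, j, k]"
      using that distinct_residues_iff[of "[i, j, k]"] by (intro X_triangle) auto
  qed
  show ?thesis using assms by (rule dunkl_power_sum)
qed

end

section \<open>Finiteness in the affine symmetric group\<close>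

lemma word_product_Nil [simp]: "word_product n [] = id"
  by (simp add: word_product_def)

lemma word_product_Cons [simp]:
  "word_product n (k # ks) = reflection n (int k) (int k + 1) \<circ> word_product n ks"
  by (simp add: word_product_def)

lemma word_product_append: "word_product n (ks @ ls) = word_product n ks \<circ> word_product n ls"
  by (induction ks) (auto simp: comp_assoc)

lemma affine_sym_comp: "v \<in> affine_sym n \<Longrightarrow> w \<in> affine_sym n \<Longrightarrow> v \<circ> w \<in> affine_sym n"
  unfolding affine_sym_def
  by (auto simp: word_product_append[symmetric] simp del: in_lists_conv_set intro!: imageI)

section \<open>Reflections as elements of the affine symmetric group\<close>

lemma reflection_mod:
  "reflection n i j k mod int n =
    (if k mod int n = i mod int n then j mod int n
     else if k mod int n = j mod int n then i mod int n else k mod int n)"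
proof -
  have "(k + (j - i)) mod int n = j mod int n" if "k mod int n = i mod int n"
    using mod_add_diff_eq'[OF that, of j] by (simp add: algebra_simps)
  moreover have "(k + (i - j)) mod int n = i mod int n" if "k mod int n = j mod int n"
    using mod_add_diff_eq'[OF that, of i] by (simp add: algebra_simps)
  ultimately show ?thesis by (simp add: reflection_def)
qed

lemma reflection_involution:
  assumes "distinct_residues n [i, j]"
  shows "reflection n i j (reflection n i j k) = k"
proof -
  let ?k = "reflection n i j k"
  have "reflection n i j ?k = (if ?k mod int n = i mod int n then ?k + (j - i)
      else if ?k mod int n = j mod int n then ?k + (i - j) else ?k)"
    by (simp only: reflection_def[of n i j ?k])
  then show ?thesis
    using assms unfolding reflection_mod by (auto simp: reflection_def distinct_residues_def)
qed

lemma reflection_conj: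
  assumes "distinct_residues n [i, j, k]"
  shows "reflection n j k \<circ> reflection n i j \<circ> reflection n j k = reflection n i k"
proof
  fix a
  \<comment> \<open>The successive images of \<open>a\<close>. Their residues are determined by that
    of \<open>a\<close>, so a case split on the residue of \<open>a\<close> settles every branch of
    the three reflections.\<close>
  define b c d where "b = reflection n j k a" and "c = reflection n i j b"
    and "d = reflection n j k c"
  note mods = reflection_mod[of n j k a, folded b_def] reflection_mod[of n i j b, folded c_def]
  note vals = b_def[unfolded reflection_def] c_def[unfolded reflection_def]
    d_def[unfolded reflection_def]
  have res: "i mod int n \<noteq> j mod int n" "j mod int n \<noteq> k mod int n" "i mod int n \<noteq> k mod int n"
    using assms by (auto simp: distinct_residues_def)
  have "d = reflection n i k a"
    unfolding reflection_def
    by (cases "a mod int n = i mod int n"; cases "a mod int n = j mod int n";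
        cases "a mod int n = k mod int n")
      (use mods vals res res[symmetric] in simp_all)
  then show "(reflection n j k \<circ> reflection n i j \<circ> reflection n j k) a = reflection n i k a"
    by (simp add: b_def c_def d_def)
qed

text \<open>The counterpart of \<open>reflection_conj\<close> for \<open>j - 1\<close> in the
  residue class of \<open>i\<close>, where \<open>i\<close> and \<open>j - 1\<close> define no
  reflection. The simple reflection at \<open>i\<close> then moves both ends inward,
  \<open>i\<close> to \<open>i + 1\<close> and \<open>j\<close> to \<open>j - 1\<close>.\<close>

lemma reflection_conj_adjacent:
  assumes "distinct_residues n [i, j]" "i mod int n = (j - 1) mod int n"
  shows "reflection n i (i + 1) \<circ> reflection n (i + 1) (j - 1) \<circ> reflection n i (i + 1) = reflection n i j"
proof
  have j: "(i + 1) mod int n = j mod int n"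
    using assms(2) by (metis mod_add_left_eq diff_add_cancel)
  fix a
  define b c d where "b = reflection n i (i + 1) a" and "c = reflection n (i + 1) (j - 1) b"
    and "d = reflection n i (i + 1) c"
  note mods = reflection_mod[of n i "i + 1" a, folded b_def]
    reflection_mod[of n "i + 1" "j - 1" b, folded c_def]
  note vals = b_def[unfolded reflection_def] c_def[unfolded reflection_def]
    d_def[unfolded reflection_def]
  have res: "i mod int n \<noteq> j mod int n"
    using assms(1) by (auto simp: distinct_residues_def)
  have "d = reflection n i j a"
    unfolding reflection_def
    by (cases "a mod int n = i mod int n"; cases "a mod int n = j mod int n")
      (use mods[unfolded j assms(2)[symmetric]] vals[unfolded j assms(2)[symmetric]]
        res res[symmetric] in simp_all)
  then show "(reflection n i (i + 1) \<circ> reflection n (i + 1) (j - 1) \<circ> reflection n i (i + 1)) a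
      = reflection n i j a"
    by (simp add: b_def c_def d_def)
qed

lemma distinct_residues_Suc: "n \<ge> 2 \<Longrightarrow> distinct_residues n [i, i + 1]"
  by (auto simp: distinct_residues_def mod_eq_dvd_iff)

lemma simple_reflection_affine_sym:
  assumes "n \<ge> 2"
  shows "reflection n i (i + 1) \<in> affine_sym n"
proof -
  define k where "k = nat (i mod int n)"
  have k: "int k = i mod int n" "k < n" using assms by (auto simp: k_def nat_less_iff)
  have "reflection n i (i + 1) = reflection n (int k) (int k + 1)"
    by (auto simp: reflection_def fun_eq_iff k mod_simps)
  also have "\<dots> = word_product n [k]" by simp
  finally show ?thesis
    unfolding affine_sym_def using k(2) by (intro image_eqI[of _ _ "[k]"]) auto
qed

text \<open>Conjugation with a simple reflection shortens the interval from \<open>i\<close> to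
  \<open>j\<close>, at the right end alone or, if \<open>j - 1\<close> has the residue of
  \<open>i\<close>, at both ends.\<close>

lemma reflection_affine_sym:
  assumes "n \<ge> 2"
  shows "(i, j) \<in> symbols n \<Longrightarrow> reflection n i j \<in> affine_sym n"
proof (induction "nat (j - i)" arbitrary: i j rule: less_induct)
  case less
  then have ij: "i < j" and dr: "distinct_residues n [i, j]" by (auto simp: symbols_def)
  note simple = simple_reflection_affine_sym[OF assms]
  consider "j = i + 1" | "j \<noteq> i + 1" "i mod int n \<noteq> (j - 1) mod int n"
    | "j \<noteq> i + 1" "i mod int n = (j - 1) mod int n" by blast
  then show ?case
  proof cases
    case 1
    then show ?thesis using simple by simp
  next
    case 2
    have dr3: "distinct_residues n [i, j - 1, j]"
      using 2 dr distinct_residues_Suc[OF assms, of "j - 1"] by (auto simp: distinct_residues_def)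
    have "reflection n i (j - 1) \<in> affine_sym n"
      using 2 ij by (intro less.hyps) (auto simp: symbols_def distinct_residues_def)
    then show ?thesis
      using affine_sym_comp[OF affine_sym_comp[OF simple] simple, of _ "j - 1" "j - 1"]
        reflection_conj[OF dr3] by (metis diff_add_cancel)
  next
    case 3
    \<comment> \<open>\<open>j - 1 - i\<close> is a positive multiple of \<open>n \<ge> 2\<close>,
      which leaves room to move both ends inward without crossing.\<close>
    have "int n dvd j - 1 - i" using 3(2) by (metis mod_eq_dvd_iff)
    then have "int n \<le> j - 1 - i" using 3(1) ij by (intro zdvd_imp_le) auto
    then have "i + 1 < j - 1 \<or> j - 1 = i + 1" using assms by linarith
    moreover have "(i + 1) mod int n \<noteq> (j - 1) mod int n"
      using 3(2) distinct_residues_Suc[OF assms, of i] by (auto simp: distinct_residues_def)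
    ultimately have "i + 1 < j - 1" by (metis (no_types))
    then have "reflection n (i + 1) (j - 1) \<in> affine_sym n"
      using \<open>(i + 1) mod int n \<noteq> (j - 1) mod int n\<close>
      by (intro less.hyps) (auto simp: symbols_def distinct_residues_def)
    then show ?thesis
      using affine_sym_comp[OF affine_sym_comp[OF simple] simple, of _ i i]
        reflection_conj_adjacent[OF dr 3(2)] by metis
  qed
qed

lemma inj_affine_sym:
  assumes "n \<ge> 2" "w \<in> affine_sym n"
  shows "inj w"
proof -
  have "inj (word_product n ks)" for ks
  proof (induction ks)
    case (Cons k ks)
    have "inj (reflection n (int k) (int k + 1))"
      by (metis assms(1) distinct_residues_Suc injI reflection_involution)
    then show ?case using Cons by (simp only: word_product_Cons inj_compose)
  qed simp
  then show ?thesis using assms(2) by (auto simp: affine_sym_def)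
qed

lemma finite_bounded_length: "finite {v \<in> affine_sym n. aff_length n v \<le> l}"
proof (rule finite_subset)
  show "{v \<in> affine_sym n. aff_length n v \<le> l}
      \<subseteq> word_product n ` {ks. set ks \<subseteq> {..<n} \<and> length ks \<le> l}"
  proof
    fix v assume v: "v \<in> {v \<in> affine_sym n. aff_length n v \<le> l}"
    then have "\<exists>k. \<exists>ks\<in>lists {..<n}. length ks = k \<and> word_product n ks = v"
      by (auto simp: affine_sym_def)
    then have "\<exists>ks\<in>lists {..<n}. length ks = aff_length n v \<and> word_product n ks = v"
      unfolding aff_length_def by (rule LeastI_ex)
    then show "v \<in> word_product n ` {ks. set ks \<subseteq> {..<n} \<and> length ks \<le> l}"
      using v by (auto simp: in_lists_conv_set)
  qed
  show "finite (word_product n ` {ks. set ks \<subseteq> {..<n} \<and> length ks \<le> l})"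
    by (intro finite_imageI finite_lists_length_le) simp
qed

section \<open>Letters acting on basis elements\<close>

lemma act_letter_affine_sym:
  assumes "n \<ge> 2" "w \<in> affine_sym n" "a \<in> symbols n" "act_letter n w a = Some v"
  shows "v \<in> affine_sym n"
proof -
  have "reflection n (fst a) (snd a) \<in> affine_sym n"
    using assms(1,3) by (cases a) (auto intro: reflection_affine_sym)
  then show ?thesis
    using assms(2,4) by (auto simp: act_letter_def Let_def intro: affine_sym_comp split: if_splits)
qed

lemma act_word_affine_sym:
  assumes "n \<ge> 2"
  shows "w \<in> affine_sym n \<Longrightarrow> u \<in> lists (symbols n) \<Longrightarrow> act_word n w u = Some v \<Longrightarrow> v \<in> affine_sym n"
  by (induction u arbitrary: w)
    (auto simp: bind_eq_Some_conv intro: act_letter_affine_sym[OF assms])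

lemma act_word_append:
  "act_word n w (u @ v) = Option.bind (act_word n w u) (\<lambda>w'. act_word n w' v)"
  by (induction u arbitrary: w) auto

definition letters_at :: "nat \<Rightarrow> int \<Rightarrow> letter set" where
  "letters_at n i = {a \<in> symbols n. fst a = i \<or> snd a = i}"

text \<open>The image of \<open>A\<^sub>w\<close> under \<open>[ij]\<close> determines \<open>j\<close>, and there are finitely many candidates
  for it since its length is bounded.\<close>

lemma finite_letters_at:
  assumes "n \<ge> 2" "w \<in> affine_sym n"
  shows "finite {a \<in> letters_at n i. act_letter n w a \<noteq> None}"
proof (rule finite_subset)
  let ?F = "{v \<in> affine_sym n. aff_length n v \<le> aff_length n w}"
  \<comment> \<open>Recovers the letter from the image: if its other endpoint is \<open>j\<close>,
    then \<open>v i = w j\<close>, so the inverse of \<open>w\<close> yields \<open>j\<close>.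
    Minimum and maximum put the endpoints in order.\<close>
  let ?g = "\<lambda>v. (min i (the_inv w (v i)), max i (the_inv w (v i)))"
  show "{a \<in> letters_at n i. act_letter n w a \<noteq> None} \<subseteq> ?g ` ?F"
  proof
    fix a assume a: "a \<in> {a \<in> letters_at n i. act_letter n w a \<noteq> None}"
    then obtain v where v: "act_letter n w a = Some v" by auto
    have sym: "a \<in> symbols n" using a by (simp add: letters_at_def)
    have vF: "v \<in> ?F"
      using act_letter_affine_sym[OF assms sym v] v
      by (auto simp: act_letter_def Let_def split: if_splits)
    have veq: "v = w \<circ> reflection n (fst a) (snd a)"
      using v by (auto simp: act_letter_def Let_def split: if_splits)
    have "the_inv w (v i) = reflection n (fst a) (snd a) i"
      using inj_affine_sym[OF assms] by (simp add: veq the_inv_f_f)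
    moreover have "reflection n (fst a) (snd a) i = (if fst a = i then snd a else fst a)"
      using a by (auto simp: letters_at_def symbols_def reflection_def distinct_residues_def)
    ultimately have "a = ?g v"
      using a by (auto simp: letters_at_def symbols_def)
    then show "a \<in> ?g ` ?F" using vF by blast
  qed
  show "finite (?g ` ?F)" by (intro finite_imageI finite_bounded_length)
qed

section \<open>Series with finite action\<close>

lemma ser_mult_Nil: "ser_mult f g [] = f [] * g []"
  by (simp add: ser_mult_def)

lemma ser_mult_Cons: "ser_mult f g (a # u) = f [] * g (a # u) + ser_mult (\<lambda>v. f (a # v)) g u"
  by (simp add: ser_mult_def sum.atMost_Suc_shift del: sum.atMost_Suc)

lemma ser_mult_scale_left: "ser_mult (\<lambda>v. c * f v) g u = c * ser_mult f g u"
  by (simp add: ser_mult_def sum_distrib_left mult.assoc)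

lemma ser_mult_add_left: "ser_mult (ser_add f g) h u = ser_mult f h u + ser_mult g h u"
  by (simp add: ser_mult_def sum.distrib distrib_right)

lemma ser_mult_add_right: "ser_mult f (ser_add g h) u = ser_mult f g u + ser_mult f h u"
  by (simp add: ser_mult_def sum.distrib distrib_left)

text \<open>Induction on the word by \<open>ser_mult_Cons\<close>. The left factor must be
  arbitrary, because removing the first letter \<open>a\<close> replaces it by
  \<open>\<lambda>v. f (a # v)\<close>.\<close>

lemma ser_mult_assoc: "ser_mult (ser_mult f g) h u = ser_mult f (ser_mult g h) u"
proof (induction u arbitrary: f)
  case Nil
  then show ?case by (simp add: ser_mult_Nil mult.assoc)
next
  case (Cons a u)
  have "(\<lambda>v. ser_mult f g (a # v)) = ser_add (\<lambda>v. f [] * g (a # v)) (ser_mult (\<lambda>v. f (a # v)) g)"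
    by (simp add: ser_mult_Cons)
  then have "ser_mult (\<lambda>v. ser_mult f g (a # v)) h u =
      f [] * ser_mult (\<lambda>v. g (a # v)) h u + ser_mult (ser_mult (\<lambda>v. f (a # v)) g) h u"
    by (simp only: ser_mult_add_left ser_mult_scale_left)
  then show ?case
    by (simp add: ser_mult_Cons[of "ser_mult f g"] ser_mult_Cons[of f "ser_mult g h"]
        ser_mult_Cons[of g h] ser_mult_Nil Cons algebra_simps)
qed

lemma ser_mult_one_left: "ser_mult (monomial []) f u = f u"
proof -
  have "ser_mult (\<lambda>v. 0) f u = (0 :: 'a)" for u by (simp add: ser_mult_def)
  then show ?thesis by (cases u) (simp_all add: ser_mult_Nil ser_mult_Cons monomial_def)
qed

lemma ser_mult_one_right: "ser_mult f (monomial []) u = f u"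
  by (induction u arbitrary: f) (simp_all add: ser_mult_Nil ser_mult_Cons monomial_def)

lemma ser_mult_nonzero:
  assumes "ser_mult f g u \<noteq> 0"
  obtains v w where "u = v @ w" "f v \<noteq> 0" "g w \<noteq> 0"
proof -
  from assms obtain k where "f (take k u) * g (drop k u) \<noteq> 0"
    unfolding ser_mult_def by (meson sum.not_neutral_contains_not_neutral)
  then show ?thesis by (intro that[of "take k u" "drop k u"]) auto
qed

text \<open>A copy of the type of series, which allows for the type class \<open>ring_1\<close>.\<close>

typedef (overloaded) 'k nc_series = "UNIV :: 'k::comm_ring_1 series set"
  morphisms coeff Series by simp

setup_lifting type_definition_nc_series

instantiation nc_series :: (comm_ring_1) ring_1
begin

lift_definition zero_nc_series :: "'a nc_series" is "\<lambda>_. 0" .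
lift_definition one_nc_series :: "'a nc_series" is "monomial []" .
lift_definition plus_nc_series :: "'a nc_series \<Rightarrow> 'a nc_series \<Rightarrow> 'a nc_series" is ser_add .
lift_definition minus_nc_series :: "'a nc_series \<Rightarrow> 'a nc_series \<Rightarrow> 'a nc_series" is ser_diff .
lift_definition uminus_nc_series :: "'a nc_series \<Rightarrow> 'a nc_series" is "\<lambda>f u. - f u" .
lift_definition times_nc_series :: "'a nc_series \<Rightarrow> 'a nc_series \<Rightarrow> 'a nc_series" is ser_mult .

instance
proof
  have "monomial [] [] \<noteq> (0 :: 'a)" by (simp add: monomial_def)
  then show "(0 :: 'a nc_series) \<noteq> 1" by transfer (metis (no_types))
qed (transfer; auto simp: fun_eq_iff ser_mult_assoc ser_mult_one_left ser_mult_one_right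
    ser_mult_add_left ser_mult_add_right)+

end

lemma coeff_sum: "coeff (sum f A) u = (\<Sum>a\<in>A. coeff (f a) u)"
  by (induction A rule: infinite_finite_induct)
    (simp_all add: zero_nc_series.rep_eq plus_nc_series.rep_eq)

lemmas coeff_simps = zero_nc_series.rep_eq one_nc_series.rep_eq plus_nc_series.rep_eq
  minus_nc_series.rep_eq uminus_nc_series.rep_eq times_nc_series.rep_eq Series_inverse[OF UNIV_I]

section \<open>The filtrations and the completion in terms of supports\<close>

definition small_word :: "nat \<Rightarrow> letter list \<Rightarrow> bool" where
  "small_word N u \<longleftrightarrow> (\<forall>(i, j)\<in>set u. \<bar>i\<bar> < int N \<and> \<bar>j\<bar> < int N)"

lemma small_word_append [simp]: "small_word N (u @ v) \<longleftrightarrow> small_word N u \<and> small_word N v"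
  by (auto simp: small_word_def)

lemma index_filt_iff: "f \<in> index_filt N \<longleftrightarrow> (\<forall>u. small_word N u \<longrightarrow> f u = 0)"
proof -
  have "small_word N u \<longleftrightarrow> \<not> (\<exists>(i, j)\<in>set u. int N \<le> \<bar>i\<bar> \<or> int N \<le> \<bar>j\<bar>)" for u
    by (auto simp: small_word_def case_prod_beta not_le)
  then show ?thesis unfolding index_filt_def by blast
qed

definition narrow_word :: "nat \<Rightarrow> letter list \<Rightarrow> bool" where
  "narrow_word N u \<longleftrightarrow> (\<forall>(i, j)\<in>set u. \<bar>i - j\<bar> < int N)"

lemma narrow_word_append [simp]: "narrow_word N (u @ v) \<longleftrightarrow> narrow_word N u \<and> narrow_word N v"
  by (auto simp: narrow_word_def)

lemma width_filt_iff: "f \<in> width_filt N \<longleftrightarrow> (\<forall>u. narrow_word N u \<longrightarrow> f u = 0)"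
proof -
  have "narrow_word N u \<longleftrightarrow> \<not> (\<exists>(i, j)\<in>set u. int N \<le> \<bar>i - j\<bar>)" for u
    by (auto simp: narrow_word_def case_prod_beta not_le)
  then show ?thesis unfolding width_filt_def by blast
qed

lemma width_filt_mult:
  assumes "f \<in> width_filt N \<or> g \<in> width_filt N"
  shows "ser_mult f g \<in> width_filt N"
  unfolding width_filt_iff
proof (intro allI impI, rule ccontr)
  fix u assume "narrow_word N u" "ser_mult f g u \<noteq> 0"
  then show False using assms by (auto simp: width_filt_iff elim!: ser_mult_nonzero)
qed

text \<open>An approximation modulo \<open>index_filt N\<close> must agree with \<open>f\<close> on
  small words, and its support is finite. Conversely, the restriction of \<open>f\<close> to small
  words is such an approximation. Membership in the closure thus becomes a condition on
  supports.\<close>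

lemma completed_alg_iff:
  "f \<in> completed_alg n \<longleftrightarrow>
    {u. f u \<noteq> 0} \<subseteq> lists (symbols n) \<and> (\<forall>N. finite {u. f u \<noteq> 0 \<and> small_word N u})"
  (is "?L \<longleftrightarrow> ?S \<and> ?R")
proof
  assume L: ?L
  have "finite {u. f u \<noteq> 0 \<and> small_word N u}" for N
  proof -
    obtain p where p: "p \<in> free_alg n" "ser_diff f p \<in> index_filt N"
      using L unfolding completed_alg_def by blast
    have "{u. f u \<noteq> 0 \<and> small_word N u} \<subseteq> {u. p u \<noteq> 0}"
      using p(2) by (auto simp: index_filt_iff)
    then show ?thesis using p(1) finite_subset by (auto simp: free_alg_def)
  qed
  then show "?S \<and> ?R" using L by (auto simp: completed_alg_def)
next
  assume R: "?S \<and> ?R"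
  have "\<exists>p\<in>free_alg n. ser_diff f p \<in> index_filt N" for N
  proof
    show "(\<lambda>u. if small_word N u then f u else 0) \<in> free_alg n"
    proof -
      have "{u. (if small_word N u then f u else 0) \<noteq> 0} = {u. f u \<noteq> 0 \<and> small_word N u}"
        by auto
      then show ?thesis using R by (auto simp: free_alg_def)
    qed
    show "ser_diff f (\<lambda>u. if small_word N u then f u else 0) \<in> index_filt N"
      by (simp add: index_filt_iff)
  qed
  then show ?L using R by (simp add: completed_alg_def)
qed

text \<open>Only finitely many letters are small, hence only finitely many small words have bounded
  length. This covers the infinite sums of words with one or two letters.\<close>

lemma completed_alg_bounded_length:
  assumes "\<And>u. f u \<noteq> 0 \<Longrightarrow> u \<in> lists (symbols n) \<and> length u \<le> l"
  shows "f \<in> completed_alg n"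
  unfolding completed_alg_iff
proof (intro conjI allI)
  show "{u. f u \<noteq> 0} \<subseteq> lists (symbols n)" using assms by blast
  fix N
  let ?B = "{- int N..int N} \<times> {- int N..int N}"
  have "{u. f u \<noteq> 0 \<and> small_word N u} \<subseteq> {u. set u \<subseteq> ?B \<and> length u \<le> l}"
    using assms by (fastforce simp: small_word_def)
  then show "finite {u. f u \<noteq> 0 \<and> small_word N u}"
    by (rule finite_subset) (intro finite_lists_length_le, simp)
qed

section \<open>Closure of the series with finite action under the ring operations\<close>

lemma finite_append_pairs:
  assumes "finite U" "\<And>u. u \<in> U \<Longrightarrow> finite (V u)"
  shows "finite {u @ v |u v. u \<in> U \<and> v \<in> V u}"
proof -
  have "{u @ v |u v. u \<in> U \<and> v \<in> V u} = (\<lambda>(u, v). u @ v) ` (SIGMA u:U. V u)" by auto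
  then show ?thesis using assms by simp
qed

lemma completed_alg_mult:
  assumes f: "f \<in> completed_alg n" and g: "g \<in> completed_alg n"
  shows "ser_mult f g \<in> completed_alg n"
  unfolding completed_alg_iff
proof (intro conjI allI)
  show "{u. ser_mult f g u \<noteq> 0} \<subseteq> lists (symbols n)"
    using f g by (fastforce simp: completed_alg_iff elim!: ser_mult_nonzero)
  fix N
  let ?U = "\<lambda>f. {u. f u \<noteq> 0 \<and> small_word N u}"
  have "finite {u @ v |u v. u \<in> ?U f \<and> v \<in> ?U g}"
    using f g by (intro finite_append_pairs) (auto simp: completed_alg_iff)
  then show "finite (?U (ser_mult f g))"
    by (rule finite_subset[rotated]) (force elim!: ser_mult_nonzero)
qed

text \<open>A word with nonzero action splits into a word of \<open>f\<close> and a word of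
  \<open>g\<close>. There are finitely many choices for the first, and each leads to one basis
  element, still indexed by the group, for which there are finitely many choices of the
  second.\<close>

lemma finite_action_mult:
  assumes n: "n \<ge> 2" and f: "f \<in> finite_action n" and g: "g \<in> finite_action n"
  shows "ser_mult f g \<in> finite_action n"
  unfolding finite_action_def
proof (intro CollectI conjI ballI)
  show "ser_mult f g \<in> completed_alg n"
    using f g by (auto simp: finite_action_def intro: completed_alg_mult)
  fix w assume w: "w \<in> affine_sym n"
  let ?U = "{u. f u \<noteq> 0 \<and> act_word n w u \<noteq> None}"
  let ?V = "\<lambda>u. {v. g v \<noteq> 0 \<and> act_word n (the (act_word n w u)) v \<noteq> None}"
  have "finite {u @ v |u v. u \<in> ?U \<and> v \<in> ?V u}"
  proof (rule finite_append_pairs)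
    show "finite ?U" using f w by (auto simp: finite_action_def)
    fix u assume u: "u \<in> ?U"
    then have "u \<in> lists (symbols n)" using f by (auto simp: finite_action_def completed_alg_iff)
    then have "the (act_word n w u) \<in> affine_sym n"
      using act_word_affine_sym[OF n w] u by auto
    then show "finite (?V u)" using g by (auto simp: finite_action_def)
  qed
  then show "finite {u. ser_mult f g u \<noteq> 0 \<and> act_word n w u \<noteq> None}"
  proof (rule finite_subset[rotated], safe)
    fix u v assume u: "ser_mult f g u \<noteq> 0" "act_word n w u = Some v"
    then obtain p q where "u = p @ q" "f p \<noteq> 0" "g q \<noteq> 0" by (elim ser_mult_nonzero)
    then show "\<exists>p q. u = p @ q \<and> p \<in> ?U \<and> q \<in> ?V p"
      using u(2) by (intro exI[of _ p] exI[of _ q]) (auto simp: act_word_append bind_eq_Some_conv)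
  qed
qed

lemma finite_action_diff:
  assumes f: "f \<in> finite_action n" and g: "g \<in> finite_action n"
  shows "ser_diff f g \<in> finite_action n"
proof -
  have sub: "{u. f u - g u \<noteq> 0 \<and> P u} \<subseteq> {u. f u \<noteq> 0 \<and> P u} \<union> {u. g u \<noteq> 0 \<and> P u}" for P
    by auto
  have "ser_diff f g \<in> completed_alg n"
    unfolding completed_alg_iff
  proof (intro conjI allI)
    show "{u. f u - g u \<noteq> 0} \<subseteq> lists (symbols n)"
      using sub[of "\<lambda>_. True"] f g
      unfolding finite_action_def completed_alg_iff simp_thms by blast
    show "finite {u. f u - g u \<noteq> 0 \<and> small_word N u}" for N
      using f g by (intro finite_subset[OF sub]) (auto simp: finite_action_def completed_alg_iff)
  qed
  then show ?thesis
    using f g by (auto simp: finite_action_def simp del: right_minus_eq intro!: finite_subset[OF sub])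
qed

lemma finite_action_finite_support:
  assumes "finite {u. f u \<noteq> 0}" "{u. f u \<noteq> 0} \<subseteq> lists (symbols n)"
  shows "f \<in> finite_action n"
  using assms by (auto simp: finite_action_def completed_alg_iff)

lemma finite_action_monomial: "u \<in> lists (symbols n) \<Longrightarrow> monomial u \<in> finite_action n"
  by (rule finite_action_finite_support) (auto simp: monomial_def)

lemma finite_action_zero: "(\<lambda>_. 0) \<in> finite_action n"
  by (rule finite_action_finite_support) auto

lemma finite_action_br:
  assumes "distinct_residues n [i, j]"
  shows "br i j \<in> finite_action n"
proof (rule finite_action_finite_support)
  have "{u. br i j u \<noteq> (0::'a)} \<subseteq> {[(min i j, max i j)]}"
    by (auto simp: br_def monomial_def split: if_splits)
  moreover have "(min i j, max i j) \<in> symbols n"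
    using assms by (cases i j rule: linorder_cases) (auto simp: symbols_def distinct_residues_def)
  ultimately show "finite {u. br i j u \<noteq> (0::'a)}"
    and "{u. br i j u \<noteq> (0::'a)} \<subseteq> lists (symbols n)"
    by (auto intro: finite_subset)
qed

section \<open>Infinite sums with finite action\<close>

lemma br_nonzero: "br i j u \<noteq> 0 \<Longrightarrow> u = [(min i j, max i j)]"
  by (auto simp: br_def monomial_def split: if_splits)

lemma ser_mult_br_nonzero:
  assumes "ser_mult (br i j) (br k l) u \<noteq> 0"
  shows "u = [(min i j, max i j), (min k l, max k l)]"
  using assms by (elim ser_mult_nonzero) (auto dest!: br_nonzero)

lemma min_max_letters_at:
  "distinct_residues n [i, j] \<Longrightarrow> (min i j, max i j) \<in> letters_at n i"
  by (cases i j rule: linorder_cases) (auto simp: letters_at_def symbols_def distinct_residues_def)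

lemma ser_sum_nonzero:
  assumes "ser_sum I F u \<noteq> 0"
  obtains a where "a \<in> I" "F a u \<noteq> 0"
proof -
  from assms have "{a. (if a \<in> I then F a u else 0) \<noteq> 0} \<noteq> {}"
    unfolding ser_sum_def Sum_any.expand_set by (metis sum.empty)
  then show ?thesis using that by (auto split: if_splits)
qed

text \<open>\<open>Sum_any\<close> defaults to zero when infinitely many summands are nonzero. The
  finite set \<open>A\<close> excludes this default at the word \<open>u\<close>.\<close>

lemma ser_sum_eq_sum:
  assumes "finite A" "A \<subseteq> I" "\<And>a. a \<in> I \<Longrightarrow> F a u \<noteq> 0 \<Longrightarrow> a \<in> A"
  shows "ser_sum I F u = (\<Sum>a\<in>A. F a u)"
proof -
  have "ser_sum I F u = (\<Sum>a\<in>A. if a \<in> I then F a u else 0)"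
    unfolding ser_sum_def using assms by (intro Sum_any.expand_superset) (auto split: if_splits)
  also have "\<dots> = (\<Sum>a\<in>A. F a u)" using assms(2) by (intro sum.cong) auto
  finally show ?thesis .
qed

lemma letters_at_symbols: "a \<in> letters_at n i \<Longrightarrow> a \<in> symbols n"
  by (simp add: letters_at_def)

lemma finite_action_dunkl:
  assumes n: "n \<ge> 2"
  shows "dunkl n i \<in> finite_action n"
  unfolding finite_action_def
proof (intro CollectI conjI ballI)
  have supp: "\<exists>a\<in>letters_at n i. u = [a]" if "dunkl n i u \<noteq> (0::'a)" for u
    using that unfolding dunkl_def
    by (elim ser_sum_nonzero) (auto dest!: br_nonzero intro: min_max_letters_at)
  show "(dunkl n i :: 'a series) \<in> completed_alg n"
    by (rule completed_alg_bounded_length[where l = 1])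
      (use supp letters_at_symbols in fastforce)
  fix w assume w: "w \<in> affine_sym n"
  have "{u. dunkl n i u \<noteq> (0::'a) \<and> act_word n w u \<noteq> None}
      \<subseteq> (\<lambda>a. [a]) ` {a \<in> letters_at n i. act_letter n w a \<noteq> None}"
    using supp by force
  then show "finite {u. dunkl n i u \<noteq> (0::'a) \<and> act_word n w u \<noteq> None}"
    by (rule finite_subset) (intro finite_imageI finite_letters_at n w)
qed

text \<open>All words have two letters, the first with endpoint \<open>i\<close> and the second with
  endpoint \<open>j\<close>. \<open>finite_letters_at\<close> bounds the first letter at
  \<open>w\<close> and then the second one at each image of \<open>w\<close>.\<close>

lemma finite_action_residue_sum:
  assumes n: "n \<ge> 2" and dr: "distinct_residues n [i, j]"
  shows "ser_sum {(i', j'). i' mod int n = i mod int n \<and> j' mod int n = j mod int n}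
      (\<lambda>(i', j'). ser_mult (br i j') (br j i')) \<in> finite_action n"
    (is "?f \<in> _")
  unfolding finite_action_def
proof (intro CollectI conjI ballI)
  have supp: "\<exists>a\<in>letters_at n i. \<exists>b\<in>letters_at n j. u = [a, b]" if "?f u \<noteq> 0" for u
    using that
  proof (elim ser_sum_nonzero)
    fix p assume "p \<in> {(i', j'). i' mod int n = i mod int n \<and> j' mod int n = j mod int n}"
      "(case p of (i', j') \<Rightarrow> ser_mult (br i j') (br j i')) u \<noteq> 0"
    then obtain i' j' where ij': "i' mod int n = i mod int n" "j' mod int n = j mod int n"
      "u = [(min i j', max i j'), (min j i', max j i')]"
      by (auto dest!: ser_mult_br_nonzero)
    moreover have "distinct_residues n [i, j']" "distinct_residues n [j, i']"
      using ij' dr by (auto simp: distinct_residues_def)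
    ultimately show ?thesis using min_max_letters_at by blast
  qed
  show "?f \<in> completed_alg n"
    by (rule completed_alg_bounded_length[where l = 2])
      (use supp letters_at_symbols in fastforce)
  fix w assume w: "w \<in> affine_sym n"
  let ?U = "(\<lambda>a. [a]) ` {a \<in> letters_at n i. act_letter n w a \<noteq> None}"
  let ?V = "\<lambda>u. (\<lambda>b. [b]) ` {b \<in> letters_at n j. act_letter n (the (act_word n w u)) b \<noteq> None}"
  have "finite {u @ v |u v. u \<in> ?U \<and> v \<in> ?V u}"
  proof (rule finite_append_pairs)
    show "finite ?U" by (intro finite_imageI finite_letters_at n w)
    fix u assume "u \<in> ?U"
    then have "u \<in> lists (symbols n)" "act_word n w u \<noteq> None"
      using letters_at_symbols by auto
    then have "the (act_word n w u) \<in> affine_sym n"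
      using act_word_affine_sym[OF n w] by auto
    then show "finite (?V u)" by (intro finite_imageI finite_letters_at n)
  qed
  moreover have "{u. ?f u \<noteq> 0 \<and> act_word n w u \<noteq> None} \<subseteq> {u @ v |u v. u \<in> ?U \<and> v \<in> ?V u}"
  proof safe
    fix u v assume u: "?f u \<noteq> 0" "act_word n w u = Some v"
    from supp[OF u(1)] obtain a b where ab: "a \<in> letters_at n i" "b \<in> letters_at n j" "u = [a, b]"
      by blast
    then obtain w' where "act_letter n w a = Some w'" "act_letter n w' b = Some v"
      using u(2) by (auto simp: bind_eq_Some_conv)
    then show "\<exists>p q. u = p @ q \<and> p \<in> ?U \<and> q \<in> ?V p"
      using ab by (intro exI[of _ "[a]"] exI[of _ "[b]"]) auto
  qed
  ultimately show "finite {u. ?f u \<noteq> 0 \<and> act_word n w u \<noteq> None}"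
    using finite_subset by blast
qed

lemma finite_action_add:
  assumes "f \<in> finite_action n" "g \<in> finite_action n"
  shows "ser_add f g \<in> finite_action n"
  using finite_action_diff[OF assms(1) finite_action_diff[OF finite_action_zero assms(2)]] by simp

text \<open>Places the relators in the carrier of \<open>E_alg n\<close>, so that they generate an
  ideal there. Relation (d) is the one with an infinite sum; the others are finite combinations of
  products of \<open>br\<close>.\<close>

lemma relators_finite_action:
  assumes n: "n \<ge> 2"
  shows "relators c n \<subseteq> finite_action n"
proof
  fix f assume "f \<in> relators c n"
  then show "f \<in> finite_action n"
  proof cases
    case (residue_sum i j)
    then show ?thesis using finite_action_residue_sum[OF n] by simp
  qed (cases c; auto intro!: finite_action_diff finite_action_add finite_action_mult[OF n]
      finite_action_br simp: distinct_residues_def)+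
qed

lemma ring_E_alg:
  assumes n: "n \<ge> 2"
  shows "ring (E_alg n :: 'k::comm_ring_1 series ring)"
proof (rule ringI)
  show "abelian_group (E_alg n :: 'k series ring)"
  proof (rule abelian_groupI)
    fix f :: "'k series" assume f: "f \<in> carrier (E_alg n)"
    then have "(\<lambda>u. 0 - f u) \<in> finite_action n"
      using finite_action_diff[OF finite_action_zero] by (auto simp: E_alg_def)
    then show "\<exists>g\<in>carrier (E_alg n). g \<oplus>\<^bsub>E_alg n\<^esub> f = \<zero>\<^bsub>E_alg n\<^esub>"
      by (intro bexI[of _ "\<lambda>u. 0 - f u"]) (auto simp: E_alg_def)
  qed (auto simp: E_alg_def finite_action_add finite_action_zero add_ac)
  show "Group.monoid (E_alg n :: 'k series ring)"
    by (rule Group.monoidI)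
      (auto simp: E_alg_def finite_action_mult[OF n] finite_action_monomial ser_mult_assoc
        ser_mult_one_left ser_mult_one_right fun_eq_iff)
qed (auto simp: E_alg_def ser_mult_add_left ser_mult_add_right fun_eq_iff)

section \<open>The truncated quotients\<close>

definition action_set :: "nat \<Rightarrow> 'k::comm_ring_1 nc_series set" where
  "action_set n = {f. coeff f \<in> finite_action n}"

text \<open>The series with finite action that lie in the sum of the abstract ideal and
  \<open>width_filt N\<close>.\<close>

definition truncated_ideal :: "triangle_form \<Rightarrow> nat \<Rightarrow> nat \<Rightarrow> 'k::comm_ring_1 nc_series set" where
  "truncated_ideal c n N = {f \<in> action_set n.
     \<exists>g \<in> Idl\<^bsub>E_alg n\<^esub> (relators c n). ser_diff (coeff f) g \<in> width_filt N}"

text \<open>The closed ideal is the intersection of the truncated ones, so the theorem may be proved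
  for each \<open>N\<close> separately.\<close>

lemma relation_ideal_iff:
  "f \<in> relation_ideal c n \<longleftrightarrow> (\<forall>N. Series f \<in> truncated_ideal c n N)"
  by (auto simp: relation_ideal_def truncated_ideal_def action_set_def coeff_simps)

section \<open>The truncated ideals and the relations modulo them\<close>

context
  fixes c :: triangle_form and n :: nat
  assumes n: "n \<ge> 2"
begin

interpretation E: ring "E_alg n :: 'k::comm_ring_1 series ring"
  by (rule ring_E_alg[OF n])

lemma ideal_Idl: "ideal (Idl\<^bsub>E_alg n\<^esub> (relators c n)) (E_alg n :: 'k::comm_ring_1 series ring)"
  using relators_finite_action[OF n] by (intro E.genideal_ideal) (simp add: E_alg_def)

lemma relators_Idl: "relators c n \<subseteq> Idl\<^bsub>E_alg n\<^esub> (relators c n :: 'k::comm_ring_1 series set)"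
  using relators_finite_action[OF n] by (intro E.genideal_self) (simp add: E_alg_def)

lemma Idl_zero: "(\<lambda>_. 0) \<in> Idl\<^bsub>E_alg n\<^esub> (relators c n :: 'k::comm_ring_1 series set)"
  using additive_subgroup.zero_closed[OF ideal.axioms(1)[OF ideal_Idl]] by (simp add: E_alg_def)

lemma Idl_mult_left:
  fixes f g :: "'k::comm_ring_1 series"
  assumes "f \<in> finite_action n" "g \<in> Idl\<^bsub>E_alg n\<^esub> (relators c n)"
  shows "ser_mult f g \<in> Idl\<^bsub>E_alg n\<^esub> (relators c n)"
  using ideal.I_l_closed[OF ideal_Idl assms(2), of f] assms(1) by (simp add: E_alg_def)

lemma Idl_mult_right:
  fixes f g :: "'k::comm_ring_1 series"
  assumes "g \<in> Idl\<^bsub>E_alg n\<^esub> (relators c n)" "f \<in> finite_action n"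
  shows "ser_mult g f \<in> Idl\<^bsub>E_alg n\<^esub> (relators c n)"
  using ideal.I_r_closed[OF ideal_Idl assms(1), of f] assms(2) by (simp add: E_alg_def)

lemma Idl_diff:
  fixes f g :: "'k::comm_ring_1 series"
  assumes "f \<in> Idl\<^bsub>E_alg n\<^esub> (relators c n)" "g \<in> Idl\<^bsub>E_alg n\<^esub> (relators c n)"
  shows "ser_diff f g \<in> Idl\<^bsub>E_alg n\<^esub> (relators c n)"
proof -
  \<comment> \<open>The series \<open>-1\<close>, which turns negation into multiplication by an
    element of the algebra.\<close>
  let ?h = "\<lambda>u. 0 - monomial [] u :: 'k"
  have "?h \<in> finite_action n"
    by (intro finite_action_diff finite_action_zero finite_action_monomial) simp
  then have "ser_mult ?h g \<in> Idl\<^bsub>E_alg n\<^esub> (relators c n)" using assms(2) by (rule Idl_mult_left)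
  moreover have "ser_mult ?h g = (\<lambda>u. - g u)"
    using ser_mult_scale_left[of "-1" "monomial []" g] by (auto simp: ser_mult_one_left fun_eq_iff)
  ultimately have "f \<oplus>\<^bsub>E_alg n\<^esub> (\<lambda>u. - g u) \<in> Idl\<^bsub>E_alg n\<^esub> (relators c n)"
    using assms(1) additive_subgroup.a_closed[OF ideal.axioms(1)[OF ideal_Idl]] by metis
  then show ?thesis by (simp add: E_alg_def)
qed

lemma subring_ideal_truncated:
  "subring_ideal (action_set n) (truncated_ideal c n N :: 'k::comm_ring_1 nc_series set)"
proof
  fix a b :: "'k nc_series"
  let ?I = "Idl\<^bsub>E_alg n\<^esub> (relators c n) :: 'k series set"
  show "(1 :: 'k nc_series) \<in> action_set n"
    by (simp add: action_set_def coeff_simps finite_action_monomial)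
  show "a - b \<in> action_set n" "a * b \<in> action_set n" if "a \<in> action_set n" "b \<in> action_set n"
    using that by (auto simp: action_set_def coeff_simps finite_action_diff finite_action_mult[OF n])
  show "truncated_ideal c n N \<subseteq> (action_set n :: 'k nc_series set)"
    by (auto simp: truncated_ideal_def)
  show "(0 :: 'k nc_series) \<in> truncated_ideal c n N"
    using Idl_zero
    by (auto simp: truncated_ideal_def action_set_def coeff_simps finite_action_zero width_filt_iff
        intro!: bexI[of _ "\<lambda>_. 0"])
  {
    assume a: "a \<in> truncated_ideal c n N" and b: "b \<in> truncated_ideal c n N"
    then obtain g h where gh: "g \<in> ?I" "ser_diff (coeff a) g \<in> width_filt N"
      "h \<in> ?I" "ser_diff (coeff b) h \<in> width_filt N"
      by (auto simp: truncated_ideal_def)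
    have "ser_diff (coeff (a - b)) (ser_diff g h) \<in> width_filt N"
      using gh(2,4) by (auto simp: width_filt_iff coeff_simps)
    then show "a - b \<in> truncated_ideal c n N"
      using a b Idl_diff[OF gh(1,3)]
      by (auto simp: truncated_ideal_def action_set_def coeff_simps finite_action_diff)
  }
  {
    assume a: "a \<in> action_set n" and b: "b \<in> truncated_ideal c n N"
    then obtain g where g: "g \<in> ?I" "ser_diff (coeff b) g \<in> width_filt N"
      by (auto simp: truncated_ideal_def)
    have af: "coeff a \<in> finite_action n" and bf: "coeff b \<in> finite_action n"
      using a b by (auto simp: truncated_ideal_def action_set_def)
    \<comment> \<open>Distributivity is taken from the ring type and then read off on coefficients.
      The error of the product is the error of \<open>b\<close> times \<open>a\<close>, and
      \<open>width_filt N\<close> absorbs multiplication by arbitrary series on both sides.\<close>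
    have "a * b - a * Series g = a * (b - Series g)" "b * a - Series g * a = (b - Series g) * a"
      by (simp_all add: algebra_simps)
    then have eq:
      "ser_diff (coeff (a * b)) (ser_mult (coeff a) g) = ser_mult (coeff a) (ser_diff (coeff b) g)"
      "ser_diff (coeff (b * a)) (ser_mult g (coeff a)) = ser_mult (ser_diff (coeff b) g) (coeff a)"
      by (auto dest!: arg_cong[where f = coeff] simp: coeff_simps)
    have "ser_diff (coeff (a * b)) (ser_mult (coeff a) g) \<in> width_filt N"
      "ser_diff (coeff (b * a)) (ser_mult g (coeff a)) \<in> width_filt N"
      unfolding eq using g(2) by (auto intro: width_filt_mult)
    moreover have "coeff (a * b) \<in> finite_action n" "coeff (b * a) \<in> finite_action n"
      using af bf by (simp_all add: coeff_simps finite_action_mult[OF n])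
    ultimately show "a * b \<in> truncated_ideal c n N" "b * a \<in> truncated_ideal c n N"
      using Idl_mult_left[OF af g(1)] Idl_mult_right[OF g(1) af]
      by (auto simp: truncated_ideal_def action_set_def)
  }
qed

lemma width_filt_truncated_ideal:
  "f \<in> finite_action n \<Longrightarrow> f \<in> width_filt N \<Longrightarrow> Series f \<in> truncated_ideal c n N"
  using Idl_zero by (auto simp: truncated_ideal_def action_set_def coeff_simps intro!: bexI[of _ "\<lambda>_. 0"])

lemma relators_truncated_ideal:
  assumes "f \<in> relators c n"
  shows "Series f \<in> truncated_ideal c n N"
  using assms relators_Idl relators_finite_action[OF n]
  by (auto simp: truncated_ideal_def action_set_def coeff_simps width_filt_iff intro!: bexI[of _ f])

text \<open>The relators lie in every truncated ideal, and wide letters lie in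
  \<open>width_filt N\<close>. The remaining point is that the infinite sum of (d) may be replaced
  by a product of two finite sums.\<close>

lemma affine_FK_modulo_truncated:
  "affine_FK_modulo (action_set n) (truncated_ideal c n N) n N
    (\<lambda>i j. Series (br i j) :: 'k::comm_ring_1 nc_series)"
proof -
  interpret subring_ideal "action_set n" "truncated_ideal c n N :: 'k nc_series set"
    by (rule subring_ideal_truncated)
  let ?b = "\<lambda>i j. Series (br i j) :: 'k nc_series"
  have bE: "?b i j \<in> action_set n" if "distinct_residues n [i, j]" for i j
    using that by (simp add: action_set_def coeff_simps finite_action_br)
  have rel: "cg a b" if "a \<in> action_set n" "b \<in> action_set n"
    "ser_diff (coeff a) (coeff b) \<in> relators c n" for a b :: "'k nc_series"
    using that relators_truncated_ideal[OF that(3)]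
    by (simp add: cg_def minus_nc_series_def map_fun_def comp_def)
  show ?thesis
  proof
    fix i j k l :: int
    show "n > 0" using n by simp
    show "cg (?b i j * ?b k l) (?b k l * ?b i j)" if "distinct_residues n [i, j, k, l]"
      using relators.commute[OF that, of c] that
      by (intro rel mult_E bE) (auto simp: coeff_simps distinct_residues_def)
    show "cg (?b i j * ?b j k) (?b j k * ?b i k + ?b i k * ?b i j)" if "distinct_residues n [i, j, k]"
      using relators.triangle1[OF that, of c] that
      by (intro rel mult_E add_E bE) (auto simp: coeff_simps distinct_residues_def)
    assume dr: "distinct_residues n [i, j]"
    show "?b i j \<in> action_set n" by (rule bE[OF dr])
    have "br j i = (\<lambda>u. - br i j u :: 'k)"
      using dr by (cases i j rule: linorder_cases) (auto simp: br_def distinct_residues_def)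
    then show "?b j i = - ?b i j"
      by (simp add: uminus_nc_series_def coeff_simps)
    show "cg (?b i j) (?b (i + int n) (j + int n))"
      using relators.shift[OF dr, of c] dr
      by (intro rel bE) (auto simp: coeff_simps distinct_residues_def)
    show "?b i j \<in> truncated_ideal c n N" if wide: "int N \<le> \<bar>i - j\<bar>"
    proof (rule width_filt_truncated_ideal[OF finite_action_br[OF dr]])
      show "(br i j :: 'k series) \<in> width_filt N"
        unfolding width_filt_def using wide
        by (auto dest!: br_nonzero simp: min_def max_def abs_minus_commute)
    qed
    define A where "A = near n N j i \<times> near n N i j"
    define f where "f = ser_sum {(i', j'). i' mod int n = i mod int n \<and> j' mod int n = j mod int n}
      (\<lambda>(i', j'). ser_mult (br i j') (br j i') :: 'k series)"
    define P where "P = (\<Sum>j'\<in>near n N i j. ?b i j') * (\<Sum>i'\<in>near n N j i. ?b j i')"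
    have P: "P = (\<Sum>(i', j')\<in>A. ?b i j' * ?b j i')"
      unfolding P_def A_def sum_product sum.cartesian_product[symmetric] by (rule sum.swap)
    have PE: "P \<in> action_set n"
      unfolding P_def using dr
      by (intro mult_E sum_E bE) (auto simp: near_def distinct_residues_def)
    \<comment> \<open>A word of (d) consists of the letters with endpoints \<open>i\<close>,
      \<open>j'\<close> and \<open>j\<close>, \<open>i'\<close>. If it is narrow, then
      \<open>j'\<close> is near \<open>i\<close> and \<open>i'\<close> is near \<open>j\<close>, so
      only pairs in \<open>A\<close> contribute to its coefficient.\<close>
    have "coeff P u = f u" if "narrow_word N u" for u
    proof -
      have "f u = (\<Sum>a\<in>A. (case a of (i', j') \<Rightarrow> ser_mult (br i j') (br j i')) u)"
        unfolding f_def
      proof (rule ser_sum_eq_sum)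
        show "finite A" by (simp add: A_def finite_near)
        show "A \<subseteq> {(i', j'). i' mod int n = i mod int n \<and> j' mod int n = j mod int n}"
          by (auto simp: A_def near_def)
        fix a assume a: "a \<in> {(i', j'). i' mod int n = i mod int n \<and> j' mod int n = j mod int n}"
          "(case a of (i', j') \<Rightarrow> ser_mult (br i j') (br j i')) u \<noteq> (0::'k)"
        then obtain i' j' where ij: "a = (i', j')" "u = [(min i j', max i j'), (min j i', max j i')]"
          by (auto dest!: ser_mult_br_nonzero)
        then have "\<bar>j' - i\<bar> < int N" "\<bar>i' - j\<bar> < int N"
          using that by (auto simp: narrow_word_def min_def max_def split: if_splits)
        then show "a \<in> A" using a(1) ij(1) by (auto simp: A_def near_def)
      qed
      then show ?thesis
        unfolding P coeff_sum by (auto simp: coeff_simps intro!: sum.cong)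
    qed
    moreover have "f \<in> Idl\<^bsub>E_alg n\<^esub> (relators c n)"
      using relators.residue_sum[OF dr, of c] relators_Idl unfolding f_def by blast
    ultimately show "P \<in> truncated_ideal c n N"
      using PE by (auto simp: truncated_ideal_def width_filt_iff)
  qed
qed

text \<open>Modulo the truncated ideal each Dunkl element is the finite sum of the
  \<open>X i j\<close>. This congruence passes to powers and sums, which reduces the claim to
  \<open>X_power_sum\<close>.\<close>

lemma dunkl_power_sum_truncated:
  assumes "m \<ge> 1"
  shows "(\<Sum>i\<in>{1..int n}. (Series (dunkl n i) :: 'k::comm_ring_1 nc_series) ^ m) \<in> truncated_ideal c n N"
proof -
  let ?b = "\<lambda>i j. Series (br i j) :: 'k nc_series"
  interpret affine_FK_modulo "action_set n" "truncated_ideal c n N" n N ?b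
    by (rule affine_FK_modulo_truncated)
  have "cg (Series (dunkl n i)) (\<Sum>j\<in>{1..int n} - {i}. X i j)" if i: "i \<in> {1..int n}" for i
  proof -
    define A where "A = {j. distinct_residues n [i, j] \<and> \<bar>j - i\<bar> < int N}"
    have fin: "finite A"
      by (rule finite_subset[of _ "{i - int N..i + int N}"]) (auto simp: A_def)
    have A: "A = (\<Union>j\<in>{1..int n} - {i}. near n N i j)"
    proof (intro equalityI subsetI)
      fix j assume j: "j \<in> A"
      \<comment> \<open>The representative of \<open>j\<close> modulo \<open>n\<close> in
        \<open>{1..int n}\<close>; the shift by one avoids the range from \<open>0\<close> to
        \<open>n - 1\<close>.\<close>
      define j0 where "j0 = (j - 1) mod int n + 1"
      have "j0 mod int n = j mod int n" unfolding j0_def by (simp add: mod_simps)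
      moreover have "j0 \<in> {1..int n}" using n_pos by (simp add: j0_def add1_zle_eq)
      ultimately show "j \<in> (\<Union>j\<in>{1..int n} - {i}. near n N i j)"
        using j by (intro UN_I[of j0]) (auto simp: A_def near_def distinct_residues_def)
    next
      fix j assume "j \<in> (\<Union>j\<in>{1..int n} - {i}. near n N i j)"
      then obtain j0 where "j0 \<in> {1..int n} - {i}" "j \<in> near n N i j0" by blast
      then show "j \<in> A"
        using distinct_residues_iff[of "[i, j0]"] i by (auto simp: A_def near_def distinct_residues_def)
    qed
    have "(\<Sum>j\<in>{1..int n} - {i}. X i j) = (\<Sum>j\<in>A. ?b i j)"
      unfolding A X_def
    proof (rule sum.UNION_disjoint[symmetric])
      show "\<forall>j\<in>{1..int n} - {i}. \<forall>k\<in>{1..int n} - {i}. j \<noteq> k \<longrightarrow> near n N i j \<inter> near n N i k = {}"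
      proof (intro ballI impI)
        fix j k assume "j \<in> {1..int n} - {i}" "k \<in> {1..int n} - {i}" "j \<noteq> k"
        then show "near n N i j \<inter> near n N i k = {}"
          using distinct_residues_iff[of "[j, k]"] by (auto simp: near_def distinct_residues_def)
      qed
    qed (auto simp: finite_near)
    \<comment> \<open>Only the letters indexed by \<open>A\<close> are narrow, so the Dunkl element
      differs from the finite sum by an element of \<open>width_filt N\<close>.\<close>
    moreover have "coeff (\<Sum>j\<in>A. ?b i j) u = dunkl n i u" if "narrow_word N u" for u
    proof -
      have "dunkl n i u = (\<Sum>j\<in>A. br i j u :: 'k)"
        unfolding dunkl_def
      proof (rule ser_sum_eq_sum[OF fin])
        show "A \<subseteq> {j. distinct_residues n [i, j]}" by (auto simp: A_def)
        fix j assume "j \<in> {j. distinct_residues n [i, j]}" "br i j u \<noteq> (0::'k)"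
        then show "j \<in> A"
          using that
          by (auto dest!: br_nonzero simp: A_def narrow_word_def min_def max_def split: if_splits)
      qed
      then show ?thesis by (simp add: coeff_sum coeff_simps)
    qed
    then have "ser_diff (dunkl n i) (coeff (\<Sum>j\<in>A. ?b i j)) \<in> width_filt N"
      by (simp add: width_filt_iff)
    moreover have "(\<Sum>j\<in>A. ?b i j) \<in> action_set n"
      by (intro sum_E b_E) (simp add: A_def)
    moreover have "Series (dunkl n i) \<in> (action_set n :: 'k nc_series set)"
      by (simp add: action_set_def coeff_simps finite_action_dunkl[OF n])
    moreover from calculation
    have "Series (ser_diff (dunkl n i) (coeff (\<Sum>j\<in>A. ?b i j))) \<in> truncated_ideal c n N"
      by (intro width_filt_truncated_ideal finite_action_diff finite_action_dunkl n)
        (auto simp: action_set_def)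
    ultimately show ?thesis
      by (simp add: cg_def minus_nc_series_def map_fun_def comp_def coeff_simps)
  qed
  then show ?thesis
    by (intro cg_J[OF cg_sum[OF cg_power] X_power_sum[OF assms]])
qed

section \<open>Passage to the quotient ring\<close>

lemma ideal_relation_ideal: "ideal (relation_ideal c n) (E_alg n :: 'k::comm_ring_1 series ring)"
proof -
  have J: "subring_ideal (action_set n) (truncated_ideal c n N :: 'k nc_series set)" for N
    by (rule subring_ideal_truncated)
  \<comment> \<open>Carries the ring operations over to \<open>nc_series\<close>, where the ideal
    properties hold for every \<open>N\<close> and hence for the intersection.\<close>
  have ser: "Series (ser_add f g) = Series f + Series g" "Series (\<lambda>u. - f u) = - Series f"
    "Series (ser_mult f g) = Series f * Series g" "Series (\<lambda>_. 0) = (0 :: 'k nc_series)"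
    for f g :: "'k series"
    by (simp_all add: coeff_inject[symmetric] coeff_simps)
  have sub: "relation_ideal c n \<subseteq> finite_action n" by (auto simp: relation_ideal_def)
  have neg: "\<ominus>\<^bsub>E_alg n\<^esub> f = (\<lambda>u. - f u)" if "f \<in> finite_action n" for f :: "'k series"
  proof -
    have "(\<lambda>u. 0 - f u) \<in> finite_action n" by (intro finite_action_diff finite_action_zero that)
    then have "(\<lambda>u. - f u) \<in> carrier (E_alg n)" by (simp add: E_alg_def)
    moreover have "(\<lambda>u. - f u) \<oplus>\<^bsub>E_alg n\<^esub> f = \<zero>\<^bsub>E_alg n\<^esub>" by (simp add: E_alg_def)
    ultimately show ?thesis using that by (intro E.minus_equality) (auto simp: E_alg_def)
  qed
  show ?thesis
  proof (rule idealI[OF ring_E_alg[OF n]])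
    show "subgroup (relation_ideal c n) (add_monoid (E_alg n :: 'k series ring))"
    proof (rule group.subgroupI[OF E.add.is_group])
      show "relation_ideal c n \<subseteq> carrier (add_monoid (E_alg n :: 'k series ring))"
        using sub by (simp add: E_alg_def)
      have "(\<lambda>_. 0) \<in> (relation_ideal c n :: 'k series set)"
        using subring_ideal.zero_J[OF J] by (simp add: relation_ideal_iff ser)
      then show "(relation_ideal c n :: 'k series set) \<noteq> {}" by blast
      fix f g :: "'k series" assume f: "f \<in> relation_ideal c n"
      have "inv\<^bsub>add_monoid (E_alg n)\<^esub> f = (\<lambda>u. - f u)"
        using neg f sub by (auto simp: a_inv_def)
      then show "inv\<^bsub>add_monoid (E_alg n)\<^esub> f \<in> relation_ideal c n"
        using subring_ideal.uminus_J[OF J] f by (simp add: relation_ideal_iff ser)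
      assume g: "g \<in> relation_ideal c n"
      show "f \<otimes>\<^bsub>add_monoid (E_alg n)\<^esub> g \<in> relation_ideal c n"
        using subring_ideal.add_J[OF J] f g by (simp add: relation_ideal_iff ser E_alg_def)
    qed
    fix f g :: "'k series" assume f: "f \<in> relation_ideal c n" and g: "g \<in> carrier (E_alg n)"
    then have "Series g \<in> (action_set n :: 'k nc_series set)"
      by (simp add: action_set_def coeff_simps E_alg_def)
    then show "g \<otimes>\<^bsub>E_alg n\<^esub> f \<in> relation_ideal c n" "f \<otimes>\<^bsub>E_alg n\<^esub> g \<in> relation_ideal c n"
      using f subring_ideal.mult_J_left[OF J] subring_ideal.mult_J_right[OF J]
      by (simp_all add: relation_ideal_iff ser E_alg_def)
  qed
qed

lemma dunkl_power_sum_FK: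
  fixes m :: nat
  assumes m: "m \<ge> 1"
  shows "(\<Oplus>\<^bsub>affine_FK c n\<^esub> i \<in> {1..int n}. FK_dunkl c n i [^]\<^bsub>affine_FK c n\<^esub> m)
           = \<zero>\<^bsub>(affine_FK c n :: 'k::comm_ring_1 series set ring)\<^esub>"
proof -
  let ?I = "relation_ideal c n :: 'k series set"
  let ?Q = "affine_FK c n :: 'k series set ring"
  let ?h = "\<lambda>f. ?I +>\<^bsub>E_alg n\<^esub> f"
  have zero: "?I = \<zero>\<^bsub>?Q\<^esub>" by (simp add: affine_FK_def FactRing_def)
  interpret I: ideal ?I "E_alg n" by (rule ideal_relation_ideal)
  interpret Q: ring ?Q unfolding affine_FK_def by (rule I.quotient_is_ring)
  interpret h: ring_hom_ring "E_alg n" ?Q ?h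
    unfolding affine_FK_def by (rule I.rcos_ring_hom_ring)
  have car: "f \<in> carrier (E_alg n) \<longleftrightarrow> f \<in> finite_action n" for f :: "'k series"
    by (simp add: E_alg_def)
  have dunkl: "dunkl n i \<in> carrier (E_alg n :: 'k series ring)" for i
    by (simp add: car finite_action_dunkl[OF n])
  \<comment> \<open>Powers in \<open>E_alg n\<close> are defined by multiplication on the right,
    hence \<open>power_Suc2\<close> on the side of the ring type.\<close>
  have pow: "f [^]\<^bsub>E_alg n\<^esub> k = coeff (Series f ^ k)" for f :: "'k series" and k :: nat
  proof (induction k)
    case 0
    then show ?case by (simp add: coeff_simps E_alg_def)
  next
    case (Suc k)
    have "f [^]\<^bsub>E_alg n\<^esub> Suc k = ser_mult (coeff (Series f ^ k)) f"
      using Suc by (simp add: E_alg_def)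
    then show ?case by (simp add: coeff_simps power_Suc2 del: power_Suc)
  qed
  have pow_E: "coeff (Series (dunkl n i) ^ m) \<in> carrier (E_alg n :: 'k series ring)" for i
    using E.nat_pow_closed[OF dunkl, of i m] by (simp add: pow)
  have summand: "FK_dunkl c n i [^]\<^bsub>?Q\<^esub> m = ?h (coeff (Series (dunkl n i) ^ m))" for i
    unfolding FK_dunkl_def using h.hom_nat_pow[OF dunkl, of i m] by (simp add: pow)
  \<comment> \<open>Membership in the carrier is proved in the same induction, because additivity of
    the quotient map requires it for the partial sums.\<close>
  have "(\<Oplus>\<^bsub>?Q\<^esub> i \<in> A. FK_dunkl c n i [^]\<^bsub>?Q\<^esub> m)
      = ?h (coeff (\<Sum>i\<in>A. Series (dunkl n i) ^ m)) \<and>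
    coeff (\<Sum>i\<in>A. Series (dunkl n i) ^ m) \<in> carrier (E_alg n :: 'k series ring)"
    if "finite A" for A :: "int set"
    using that
  proof (induction A)
    case empty
    have "coeff 0 = \<zero>\<^bsub>(E_alg n :: 'k series ring)\<^esub>" by (simp add: coeff_simps E_alg_def)
    then show ?case by simp
  next
    case (insert a A)
    have "coeff (\<Sum>i\<in>insert a A. Series (dunkl n i) ^ m) =
        coeff (Series (dunkl n a) ^ m) \<oplus>\<^bsub>E_alg n\<^esub> coeff (\<Sum>i\<in>A. Series (dunkl n i :: 'k series) ^ m)"
      using insert by (simp add: coeff_simps E_alg_def)
    then show ?case
      using insert pow_E by (simp add: summand Pi_def)
  qed
  then have "(\<Oplus>\<^bsub>?Q\<^esub> i \<in> {1..int n}. FK_dunkl c n i [^]\<^bsub>?Q\<^esub> m)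
      = ?h (coeff (\<Sum>i\<in>{1..int n}. Series (dunkl n i) ^ m))" by simp
  \<comment> \<open>The coset of an element of the ideal is the ideal itself, which is the zero of
    the quotient.\<close>
  also have "\<dots> = ?I"
  proof (rule I.a_rcos_const)
    show "coeff (\<Sum>i\<in>{1..int n}. Series (dunkl n i) ^ m) \<in> ?I"
      unfolding relation_ideal_iff coeff_inverse by (intro allI dunkl_power_sum_truncated m)
  qed
  also note zero
  finally show ?thesis .
qed

end

theorem theorem4p10:
  fixes n m :: nat and c :: triangle_form
  assumes "n \<ge> 2" and "m \<ge> 1"
  shows "(\<Oplus>\<^bsub>affine_FK c n\<^esub> i \<in> {1..int n}. FK_dunkl c n i [^]\<^bsub>affine_FK c n\<^esub> m)
           = \<zero>\<^bsub>(affine_FK c n :: 'k::comm_ring_1 series set ring)\<^esub>"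
  using assms by (rule dunkl_power_sum_FK)

end
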